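(* Consider inviscid compressible fluid flow in a Riemannian manifold $(M,g)$ of dimension $n>1$, with fluid velocity vector $u$, mass density $\rho$, entropy $S$ and pressure $P$, $$u_t+(u\rfloor\nabla)u=-\rho^{-1}\,\mathrm{grad}\,P,\qquad \rho_t+\mathrm{div}(\rho u)=0,\qquad S_t+u\rfloor\nabla S=0,\qquad P=P(\rho,S),$$ with the Hamiltonian operator $$\mathcal H=\begin{pmatrix}(\rho^{-1}\mathrm{curl}\,u)\rfloor & -\mathrm{grad} & \rho^{-1}\mathrm{grad}\,S\\ -\mathrm{div}&0&0\\ -(\rho^{-1}\mathrm{grad}\,S)\rfloor&0&0\end{pmatrix}.$$ The only Casimirs arising from kinematic conserved densities $T(t,x,u,\rho,S)$ are linear combinations of the mass $\int_{\mathcal V(t)}\rho\,dV$ and the volumetric entropy $\int_{\mathcal V(t)}\rho f(S)\,dV$.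
   Context: $\nabla$ is the covariant derivative determined by $\nabla g=0$; $\mathrm{grad}$ and $\mathrm{div}$ are the Riemannian gradient and divergence (acting as total derivatives on functions of the fluid variables); $(\mathrm{curl}\,u)^{ij}=\nabla^iu^j-\nabla^ju^i$; $\rfloor$ denotes contraction, so $((\mathrm{curl}\,u)\rfloor a)^i=(\nabla^iu^j-\nabla^ju^i)a_j$; $dV$ is the Riemannian volume form; $\mathcal V(t)$ is a domain transported along the fluid streamlines; $f(S)$ is an arbitrary non-constant function. The pressure satisfies $P_\rho\neq0$ or $P_S\neq0$. A kinematic conserved density is a scalar function $T(t,x,u,\rho,S)$, non-trivial (i.e. not a total divergence $\mathrm{Div}\,\Theta$; densities depending only on $(t,x)$ are counted as trivial), for which there is a vector function $\Phi$ of $t,x,u,\rho,S$ and spatial derivatives of $u,\rho,S$ with $D_tT=-\mathrm{Div}(Tu+\Phi)$ for all formal solutions of the fluid equations, where $D_t$ and $\mathrm{Div}$ are the total time derivative and total covariant divergence. A Casimir is a conserved integral whose conserved density $T$ lies in the kernel of the Hamiltonian operator, $\mathcal H(\delta T/\delta u,\ \delta T/\delta\rho,\ \delta T/\delta S)^{\mathsf T}=0$, where $\delta/\delta u,\delta/\delta\rho,\delta/\delta S$ are variational derivatives (for $T(t,x,u,\rho,S)$, the partial derivatives).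
   Formalization: The manifold M is assumed connected; on a disconnected M the density equal to ρ on one component and 0 on the others is a further Casimir, so the claim fails there. *)

theory Defs
  imports "HOL-Analysis.Analysis" "HOL-Library.Multiset"
begin

section \<open>Riemannian manifolds in charts\<close>

text \<open>A manifold is a topological space (a type) with a smooth atlas modelled on
  \<^typ>\<open>real^'n\<close>; its dimension is \<^term>\<open>CARD('n)\<close>. Tensors are families of component
  functions, one for each chart of the atlas, related by the tensor transformation laws.\<close>

type_synonym ('m, 'n) chart = "'m set \<times> ('m \<Rightarrow> real^'n)"

definition chart_image :: "('m, 'n::finite) chart \<Rightarrow> (real^'n) set" where
  "chart_image c = snd c ` fst c"

text \<open>\<open>overlap c c'\<close> is the part of the image of \<open>c\<close> on which the coordinate change to \<open>c'\<close>
  is defined.\<close>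

definition overlap :: "('m, 'n::finite) chart \<Rightarrow> ('m, 'n) chart \<Rightarrow> (real^'n) set" where
  "overlap c c' = snd c ` (fst c \<inter> fst c')"

definition transition :: "('m, 'n::finite) chart \<Rightarrow> ('m, 'n) chart \<Rightarrow> real^'n \<Rightarrow> real^'n" where
  "transition c c' x = snd c' (inv_into (fst c) (snd c) x)"

definition partial :: "'n::finite \<Rightarrow> (real^'n \<Rightarrow> real) \<Rightarrow> real^'n \<Rightarrow> real" where
  "partial i f x = frechet_derivative f (at x) (axis i 1)"

primrec Ck_on :: "nat \<Rightarrow> (real^'n::finite) set \<Rightarrow> (real^'n \<Rightarrow> real) \<Rightarrow> bool" where
  "Ck_on 0 U f \<longleftrightarrow> continuous_on U f"
| "Ck_on (Suc k) U f \<longleftrightarrow> f differentiable_on U \<and> (\<forall>i. Ck_on k U (partial i f))"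

text \<open>Only used for open \<open>U\<close>.\<close>

definition smooth_on :: "(real^'n::finite) set \<Rightarrow> (real^'n \<Rightarrow> real) \<Rightarrow> bool" where
  "smooth_on U f \<longleftrightarrow> (\<forall>k. Ck_on k U f)"

definition smooth_atlas :: "('m::topological_space, 'n::finite) chart set \<Rightarrow> bool" where
  "smooth_atlas A \<longleftrightarrow>
     (\<Union>c\<in>A. fst c) = UNIV \<and>
     (\<forall>c\<in>A. open (fst c) \<and> open (chart_image c) \<and>
        homeomorphism (fst c) (chart_image c) (snd c) (inv_into (fst c) (snd c))) \<and>
     (\<forall>c\<in>A. \<forall>c'\<in>A. \<forall>i. smooth_on (overlap c c') (\<lambda>x. transition c c' x $ i))"

definition transition_jacobian ::
  "('m, 'n::finite) chart \<Rightarrow> ('m, 'n) chart \<Rightarrow> real^'n \<Rightarrow> real^'n^'n" where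
  "transition_jacobian c c' x = jacobian (transition c c') (at x)"

definition riemannian_metric ::
  "('m, 'n::finite) chart set \<Rightarrow> (('m, 'n) chart \<Rightarrow> real^'n \<Rightarrow> real^'n^'n) \<Rightarrow> bool" where
  "riemannian_metric A g \<longleftrightarrow>
     (\<forall>c\<in>A. (\<forall>i j. smooth_on (chart_image c) (\<lambda>x. g c x $ i $ j)) \<and>
        (\<forall>x\<in>chart_image c. transpose (g c x) = g c x \<and>
           (\<forall>v. v \<noteq> 0 \<longrightarrow> v \<bullet> (g c x *v v) > 0))) \<and>
     (\<forall>c\<in>A. \<forall>c'\<in>A. \<forall>x\<in>overlap c c'.
        g c x = transpose (transition_jacobian c c' x) ** g c' (transition c c' x)
                  ** transition_jacobian c c' x)"

text \<open>From here on \<open>h\<close> denotes the metric components \<open>g c\<close> in a fixed chart.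
  \<open>christoffel h x k i j\<close> is \<open>\<Gamma>\<^sup>k\<^sub>i\<^sub>j\<close> of the Levi-Civita connection.\<close>

definition christoffel ::
  "(real^'n \<Rightarrow> real^'n^'n) \<Rightarrow> real^'n \<Rightarrow> 'n::finite \<Rightarrow> 'n \<Rightarrow> 'n \<Rightarrow> real" where
  "christoffel h x k i j =
     (\<Sum>l\<in>UNIV. matrix_inv (h x) $ k $ l *
        (partial i (\<lambda>y. h y $ j $ l) x + partial j (\<lambda>y. h y $ i $ l) x
          - partial l (\<lambda>y. h y $ i $ j) x)) / 2"

section \<open>Jet space\<close>

text \<open>Coordinates of the jet space (in a chart) of the fluid variables: \<open>Vel i \<alpha>\<close> stands for
  the partial derivative \<open>\<partial>\<^sub>\<alpha> u\<^sup>i\<close>, where the multiset \<open>\<alpha>\<close> of coordinate indices is the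
  multi-index; likewise \<open>Dens \<alpha>\<close> and \<open>Entr \<alpha>\<close> for the mass density and the entropy.\<close>

datatype 'n coord =
  Time | Space 'n | Vel 'n "'n multiset" | Dens "'n multiset" | Entr "'n multiset"

type_synonym 'n jet = "'n coord \<Rightarrow> real"

primrec coord_order :: "'n coord \<Rightarrow> nat" where
  "coord_order Time = 0"
| "coord_order (Space i) = 0"
| "coord_order (Vel i \<alpha>) = size \<alpha>"
| "coord_order (Dens \<alpha>) = size \<alpha>"
| "coord_order (Entr \<alpha>) = size \<alpha>"

definition pos :: "'n::finite jet \<Rightarrow> real^'n" where "pos z = (\<chi> i. z (Space i))"
definition vel :: "'n::finite jet \<Rightarrow> real^'n" where "vel z = (\<chi> i. z (Vel i {#}))"
definition dens :: "'n jet \<Rightarrow> real" where "dens z = z (Dens {#})"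
definition entr :: "'n jet \<Rightarrow> real" where "entr z = z (Entr {#})"

definition jet_dom :: "('m, 'n::finite) chart \<Rightarrow> 'n jet set" where
  "jet_dom c = {z. pos z \<in> chart_image c \<and> dens z > 0}"

definition depends_only_on :: "'n jet set \<Rightarrow> 'n coord set \<Rightarrow> ('n jet \<Rightarrow> 'b) \<Rightarrow> bool" where
  "depends_only_on U C F \<longleftrightarrow> (\<forall>z\<in>U. \<forall>z'\<in>U. (\<forall>a\<in>C. z a = z' a) \<longrightarrow> F z = F z')"

definition pd :: "'n coord \<Rightarrow> ('n jet \<Rightarrow> real) \<Rightarrow> 'n jet \<Rightarrow> real" where
  "pd a F z = deriv (\<lambda>s. F (z(a := s))) (z a)"

text \<open>Continuity on jet space refers to the product topology; for functions of finitely many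
  coordinates on an open set this is the usual notion of \<open>C\<^sup>k\<close> function.\<close>

primrec Ck_jet :: "nat \<Rightarrow> 'n jet set \<Rightarrow> ('n jet \<Rightarrow> real) \<Rightarrow> bool" where
  "Ck_jet 0 U F \<longleftrightarrow> continuous_on U F"
| "Ck_jet (Suc k) U F \<longleftrightarrow> continuous_on U F \<and>
     (\<forall>a. (\<forall>z\<in>U. (\<lambda>s. F (z(a := s))) differentiable (at (z a))) \<and> Ck_jet k U (pd a F))"

definition smooth_jet :: "'n jet set \<Rightarrow> ('n jet \<Rightarrow> real) \<Rightarrow> bool" where
  "smooth_jet U F \<longleftrightarrow> (\<forall>k. Ck_jet k U F)"

subsection \<open>Jets of fluid fields and coordinate changes\<close>

definition mderiv :: "'n::finite multiset \<Rightarrow> (real^'n \<Rightarrow> real) \<Rightarrow> real^'n \<Rightarrow> real" where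
  "mderiv \<alpha> f = foldr partial (SOME l. mset l = \<alpha>) f"

definition jet_of :: "real \<Rightarrow> (real^'n::finite \<Rightarrow> real^'n) \<Rightarrow> (real^'n \<Rightarrow> real) \<Rightarrow>
    (real^'n \<Rightarrow> real) \<Rightarrow> real^'n \<Rightarrow> 'n jet" where
  "jet_of t u r s x a = (case a of
       Time \<Rightarrow> t
     | Space i \<Rightarrow> x $ i
     | Vel i \<alpha> \<Rightarrow> mderiv \<alpha> (\<lambda>y. u y $ i) x
     | Dens \<alpha> \<Rightarrow> mderiv \<alpha> r x
     | Entr \<alpha> \<Rightarrow> mderiv \<alpha> s x)"

definition smooth_fields :: "(real^'n::finite) set \<Rightarrow> (real^'n \<Rightarrow> real^'n) \<Rightarrow>
    (real^'n \<Rightarrow> real) \<Rightarrow> (real^'n \<Rightarrow> real) \<Rightarrow> bool" where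
  "smooth_fields W u r s \<longleftrightarrow> open W \<and> (\<forall>i. smooth_on W (\<lambda>x. u x $ i)) \<and>
     smooth_on W r \<and> smooth_on W s \<and> (\<forall>x\<in>W. r x > 0)"

text \<open>\<open>same_fields c c' W\<close>: the given fields on \<open>W\<close> in chart \<open>c\<close> and the given fields in
  chart \<open>c'\<close> are the components of the same velocity vector field, density and entropy.\<close>

definition same_fields :: "('m, 'n::finite) chart \<Rightarrow> ('m, 'n) chart \<Rightarrow> (real^'n) set \<Rightarrow>
    (real^'n \<Rightarrow> real^'n) \<Rightarrow> (real^'n \<Rightarrow> real) \<Rightarrow> (real^'n \<Rightarrow> real) \<Rightarrow>
    (real^'n \<Rightarrow> real^'n) \<Rightarrow> (real^'n \<Rightarrow> real) \<Rightarrow> (real^'n \<Rightarrow> real) \<Rightarrow> bool" where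
  "same_fields c c' W u r s u' r' s' \<longleftrightarrow>
     W \<subseteq> overlap c c' \<and> smooth_fields W u r s \<and> smooth_fields (transition c c' ` W) u' r' s' \<and>
     (\<forall>x\<in>W. u' (transition c c' x) = transition_jacobian c c' x *v u x \<and>
        r' (transition c c' x) = r x \<and> s' (transition c c' x) = s x)"

text \<open>Scalar and vector functions on the manifold of \<open>t, x, u, \<rho>, S\<close> and finitely many spatial
  derivatives of \<open>u, \<rho>, S\<close>. The transformation laws are expressed by evaluating on arbitrary
  fields, which spares writing out the prolongation of a coordinate change to jets.\<close>

definition scalar_function ::
  "('m, 'n::finite) chart set \<Rightarrow> (('m, 'n) chart \<Rightarrow> 'n jet \<Rightarrow> real) \<Rightarrow> bool" where
  "scalar_function A F \<longleftrightarrow>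
     (\<forall>c\<in>A. smooth_jet (jet_dom c) (F c) \<and>
        (\<exists>k. depends_only_on (jet_dom c) {a. coord_order a \<le> k} (F c))) \<and>
     (\<forall>c\<in>A. \<forall>c'\<in>A. \<forall>W u r s u' r' s' t x.
        same_fields c c' W u r s u' r' s' \<and> x \<in> W \<longrightarrow>
        F c' (jet_of t u' r' s' (transition c c' x)) = F c (jet_of t u r s x))"

definition vector_function ::
  "('m, 'n::finite) chart set \<Rightarrow> (('m, 'n) chart \<Rightarrow> 'n jet \<Rightarrow> real^'n) \<Rightarrow> bool" where
  "vector_function A F \<longleftrightarrow>
     (\<forall>c\<in>A. (\<forall>i. smooth_jet (jet_dom c) (\<lambda>z. F c z $ i)) \<and>
        (\<exists>k. depends_only_on (jet_dom c) {a. coord_order a \<le> k} (F c))) \<and>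
     (\<forall>c\<in>A. \<forall>c'\<in>A. \<forall>W u r s u' r' s' t x.
        same_fields c c' W u r s u' r' s' \<and> x \<in> W \<longrightarrow>
        F c' (jet_of t u' r' s' (transition c c' x)) =
          transition_jacobian c c' x *v F c (jet_of t u r s x))"

section \<open>Total derivative operators\<close>

text \<open>\<open>shift j z a\<close> is the total \<open>x\<^sup>j\<close>-derivative of the coordinate \<open>a\<close> at the jet \<open>z\<close>. The
  sum in \<open>total_deriv\<close> has finitely many terms when \<open>F\<close> has finite order.\<close>

primrec shift :: "'n \<Rightarrow> 'n jet \<Rightarrow> 'n coord \<Rightarrow> real" where
  "shift j z Time = 0"
| "shift j z (Space i) = (if i = j then 1 else 0)"
| "shift j z (Vel i \<alpha>) = z (Vel i (add_mset j \<alpha>))"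
| "shift j z (Dens \<alpha>) = z (Dens (add_mset j \<alpha>))"
| "shift j z (Entr \<alpha>) = z (Entr (add_mset j \<alpha>))"

definition total_deriv :: "'n \<Rightarrow> ('n jet \<Rightarrow> real) \<Rightarrow> 'n jet \<Rightarrow> real" where
  "total_deriv j F z = (\<Sum>a\<in>{a. pd a F z \<noteq> 0}. shift j z a * pd a F z)"

text \<open>\<open>covd h k X i\<close> is \<open>\<nabla>\<^sub>k X\<^sup>i\<close>, as a total derivative.\<close>

definition covd :: "(real^'n \<Rightarrow> real^'n^'n) \<Rightarrow> 'n::finite \<Rightarrow> ('n jet \<Rightarrow> real^'n) \<Rightarrow> 'n \<Rightarrow>
    'n jet \<Rightarrow> real" where
  "covd h k X i z = total_deriv k (\<lambda>w. X w $ i) z +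
     (\<Sum>j\<in>UNIV. christoffel h (pos z) i k j * X z $ j)"

definition Div :: "(real^'n \<Rightarrow> real^'n^'n) \<Rightarrow> ('n::finite jet \<Rightarrow> real^'n) \<Rightarrow> 'n jet \<Rightarrow> real" where
  "Div h X z = (\<Sum>i\<in>UNIV. covd h i X i z)"

text \<open>Raises the index of a covector.\<close>

definition sharp :: "(real^'n \<Rightarrow> real^'n^'n) \<Rightarrow> ('n::finite jet \<Rightarrow> real^'n) \<Rightarrow> 'n jet \<Rightarrow> real^'n"
  where "sharp h a z = matrix_inv (h (pos z)) *v a z"

definition Grad :: "(real^'n \<Rightarrow> real^'n^'n) \<Rightarrow> ('n::finite jet \<Rightarrow> real) \<Rightarrow> 'n jet \<Rightarrow> real^'n" where
  "Grad h F = sharp h (\<lambda>z. \<chi> j. total_deriv j F z)"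

text \<open>\<open>curl_vel h i j z\<close> is \<open>(curl u)\<^sup>i\<^sup>j = \<nabla>\<^sup>i u\<^sup>j - \<nabla>\<^sup>j u\<^sup>i\<close>.\<close>

definition curl_vel :: "(real^'n \<Rightarrow> real^'n^'n) \<Rightarrow> 'n::finite \<Rightarrow> 'n \<Rightarrow> 'n jet \<Rightarrow> real" where
  "curl_vel h i j z =
     (\<Sum>k\<in>UNIV. matrix_inv (h (pos z)) $ i $ k * covd h k vel j z) -
     (\<Sum>k\<in>UNIV. matrix_inv (h (pos z)) $ j $ k * covd h k vel i z)"

section \<open>Fluid flow, conserved densities and Casimirs\<close>

definition pressure :: "(real \<Rightarrow> real \<Rightarrow> real) \<Rightarrow> 'n jet \<Rightarrow> real" where
  "pressure P z = P (dens z) (entr z)"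

text \<open>The fluid equations at the jet \<open>z\<close>, where \<open>ut\<close>, \<open>rt\<close>, \<open>st\<close> are the values of the
  time derivatives of velocity, density and entropy.\<close>

definition fluid_equations :: "(real^'n \<Rightarrow> real^'n^'n) \<Rightarrow> (real \<Rightarrow> real \<Rightarrow> real) \<Rightarrow>
    'n::finite jet \<Rightarrow> real^'n \<Rightarrow> real \<Rightarrow> real \<Rightarrow> bool" where
  "fluid_equations h P z ut rt st \<longleftrightarrow>
     ut + (\<chi> i. \<Sum>j\<in>UNIV. vel z $ j * covd h j vel i z)
       = - (1 / dens z) *\<^sub>R Grad h (pressure P) z \<and>
     rt + Div h (\<lambda>w. dens w *\<^sub>R vel w) z = 0 \<and>
     st + (\<Sum>j\<in>UNIV. vel z $ j * total_deriv j entr z) = 0"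

text \<open>Total time derivative of a function of \<open>t, x, u, \<rho>, S\<close> only.\<close>

definition total_time_deriv :: "('n::finite jet \<Rightarrow> real) \<Rightarrow> 'n jet \<Rightarrow> real^'n \<Rightarrow> real \<Rightarrow> real \<Rightarrow> real"
  where
  "total_time_deriv T z ut rt st = pd Time T z + (\<Sum>i\<in>UNIV. ut $ i * pd (Vel i {#}) T z)
     + rt * pd (Dens {#}) T z + st * pd (Entr {#}) T z"

definition kinematic_density ::
  "('m, 'n::finite) chart set \<Rightarrow> (('m, 'n) chart \<Rightarrow> 'n jet \<Rightarrow> real) \<Rightarrow> bool" where
  "kinematic_density A T \<longleftrightarrow> scalar_function A T \<and>
     (\<forall>c\<in>A. depends_only_on (jet_dom c) {a. coord_order a = 0} (T c))"

definition trivial_density :: "('m, 'n::finite) chart set \<Rightarrow>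
    (('m, 'n) chart \<Rightarrow> real^'n \<Rightarrow> real^'n^'n) \<Rightarrow> (('m, 'n) chart \<Rightarrow> 'n jet \<Rightarrow> real) \<Rightarrow> bool" where
  "trivial_density A g T \<longleftrightarrow>
     (\<forall>c\<in>A. depends_only_on (jet_dom c) (insert Time (range Space)) (T c)) \<or>
     (\<exists>\<Theta>. vector_function A \<Theta> \<and> (\<forall>c\<in>A. \<forall>z\<in>jet_dom c. T c z = Div (g c) (\<Theta> c) z))"

text \<open>A formal solution is represented by its spatial jet \<open>z\<close> at one instant, an arbitrary
  point of jet space, and the time derivatives that the fluid equations then impose. Only first
  time derivatives enter, as \<open>T\<close> has order 0 and \<open>\<Phi>\<close> contains no time derivatives.\<close>

definition kinematic_conserved_density :: "('m, 'n::finite) chart set \<Rightarrow>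
    (('m, 'n) chart \<Rightarrow> real^'n \<Rightarrow> real^'n^'n) \<Rightarrow> (real \<Rightarrow> real \<Rightarrow> real) \<Rightarrow>
    (('m, 'n) chart \<Rightarrow> 'n jet \<Rightarrow> real) \<Rightarrow> bool" where
  "kinematic_conserved_density A g P T \<longleftrightarrow>
     kinematic_density A T \<and> \<not> trivial_density A g T \<and>
     (\<exists>\<Phi>. vector_function A \<Phi> \<and>
        (\<forall>c\<in>A. \<forall>z\<in>jet_dom c. \<forall>ut rt st. fluid_equations (g c) P z ut rt st \<longrightarrow>
           total_time_deriv (T c) z ut rt st
             = - Div (g c) (\<lambda>w. T c w *\<^sub>R vel w + \<Phi> c w) z))"

text \<open>The Hamiltonian operator applied to \<open>(a, b, s)\<close>, with \<open>a\<close> a covector.\<close>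

definition hamiltonian_op :: "(real^'n \<Rightarrow> real^'n^'n) \<Rightarrow> ('n::finite jet \<Rightarrow> real^'n) \<Rightarrow>
    ('n jet \<Rightarrow> real) \<Rightarrow> ('n jet \<Rightarrow> real) \<Rightarrow> 'n jet \<Rightarrow> (real^'n) \<times> real \<times> real" where
  "hamiltonian_op h a b s z =
     ((\<chi> i. (1 / dens z) * (\<Sum>j\<in>UNIV. curl_vel h i j z * a z $ j))
        - Grad h b z + (s z / dens z) *\<^sub>R Grad h entr z,
      - Div h (sharp h a) z,
      - (1 / dens z) * (\<Sum>i\<in>UNIV. Grad h entr z $ i * a z $ i))"

text \<open>The variational derivatives of a density of order 0 are its partial derivatives.\<close>

definition casimir_density :: "('m, 'n::finite) chart set \<Rightarrow>
    (('m, 'n) chart \<Rightarrow> real^'n \<Rightarrow> real^'n^'n) \<Rightarrow> (real \<Rightarrow> real \<Rightarrow> real) \<Rightarrow>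
    (('m, 'n) chart \<Rightarrow> 'n jet \<Rightarrow> real) \<Rightarrow> bool" where
  "casimir_density A g P T \<longleftrightarrow>
     kinematic_conserved_density A g P T \<and>
     (\<forall>c\<in>A. \<forall>z\<in>jet_dom c.
        hamiltonian_op (g c) (\<lambda>w. \<chi> i. pd (Vel i {#}) (T c) w)
          (pd (Dens {#}) (T c)) (pd (Entr {#}) (T c)) z = 0)"

text \<open>Densities that differ by a trivial density represent the same integral over
  transported domains, in the sense of the formal calculus of variations.\<close>

definition same_integral :: "('m, 'n::finite) chart set \<Rightarrow>
    (('m, 'n) chart \<Rightarrow> real^'n \<Rightarrow> real^'n^'n) \<Rightarrow> (('m, 'n) chart \<Rightarrow> 'n jet \<Rightarrow> real) \<Rightarrow>
    (('m, 'n) chart \<Rightarrow> 'n jet \<Rightarrow> real) \<Rightarrow> bool" where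
  "same_integral A g T T' \<longleftrightarrow> trivial_density A g (\<lambda>c z. T c z - T' c z)"

definition mass_density :: "('m, 'n) chart \<Rightarrow> 'n jet \<Rightarrow> real" where
  "mass_density c z = dens z"

definition entropy_density :: "(real \<Rightarrow> real) \<Rightarrow> ('m, 'n) chart \<Rightarrow> 'n jet \<Rightarrow> real" where
  "entropy_density f c z = dens z * f (entr z)"

definition smooth_nonconstant :: "(real \<Rightarrow> real) \<Rightarrow> bool" where
  "smooth_nonconstant f \<longleftrightarrow>
     (\<forall>k x. (deriv ^^ k) f differentiable (at x)) \<and> \<not> f constant_on UNIV"

end

theory Submission
  imports Defs "HOL-Computational_Algebra.Polynomial"
begin

text \<open>The kernel condition is an identity on jet space, in which the gradients of \<open>\<rho>\<close> and \<open>S\<close> are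
  free. Its last component gives \<open>T\<^sub>u = 0\<close>, and the first one then gives \<open>(T\<^sub>\<rho>)\<^sub>\<rho> = 0\<close>,
  \<open>(T\<^sub>\<rho>)\<^sub>x = 0\<close> and \<open>T\<^sub>S = \<rho> (T\<^sub>\<rho>)\<^sub>S\<close>. Hence \<open>T = \<rho> b(t, S) + R(t, x)\<close> in each chart. The conservation
  law at jets with \<open>u = 0\<close> says that \<open>T\<^sub>t = \<rho> b\<^sub>t + R\<^sub>t\<close> is a total divergence, which forces \<open>b\<^sub>t = 0\<close>:
  a total divergence whose dependence on \<open>\<rho>\<close> alone is affine, with slope \<open>\<beta>\<close>, has \<open>\<beta> = 0\<close>, because its
  integral is unchanged by a compactly supported perturbation of \<open>\<rho>\<close>. The same fact shows that
  \<open>\<rho> F(S)\<close> with \<open>F \<noteq> 0\<close> is not trivial. Finally \<open>b\<close> agrees on overlapping charts by invariance of \<open>T\<close>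
  on constant fields at rest, so connectedness makes it one function \<open>f\<close> of \<open>S\<close>.\<close>

section \<open>Calculus on jet space\<close>

text \<open>That a total divergence cannot be affine in the density with nonzero slope would usually
  be read off the Euler operator, which needs mixed higher derivatives on jet space. Integration
  replaces it. Weighted by sqrt |det g|, a covariant divergence becomes a coordinate divergence,
  whose integral over a region depends only on the field near the boundary. As a flux has finite
  order, a bump with finitely many derivatives suffices, a power of d^2 - y^2 cut off at zero.
  Smoothness on jet space is given by continuous partial derivatives in infinitely many coordinates,
  so the chain rule along curves has to be built one coordinate at a time. Jets at rest are the
  right test for the conservation law: there the flux T u has no divergence, \<rho>_t = S_t = 0
  solves the equations, and u_t is invisible because T_u = 0. Invariance of T relates values, not
  derivatives, in two charts. The slope b is therefore compared as the difference of T at densities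
  2 and 1.\<close>

lemma coord_order_finite: "finite {a :: 'n::finite coord. coord_order a \<le> k}"
proof -
  have fin: "finite {\<alpha> :: 'n multiset. size \<alpha> = k}" for k
  proof (induction k)
    case (Suc k)
    have "{\<alpha> :: 'n multiset. size \<alpha> = Suc k} \<subseteq> (\<Union>i. add_mset i ` {\<alpha>. size \<alpha> = k})"
    proof
      fix \<alpha> :: "'n multiset" assume "\<alpha> \<in> {\<alpha>. size \<alpha> = Suc k}"
      moreover from this obtain i \<beta> where "\<alpha> = add_mset i \<beta>"
        using size_eq_Suc_imp_eq_union by blast
      ultimately show "\<alpha> \<in> (\<Union>i. add_mset i ` {\<alpha>. size \<alpha> = k})"
        by auto
    qed
    then show ?case
      by (rule finite_subset) (simp add: Suc)
  qed simp
  have "{\<alpha> :: 'n multiset. size \<alpha> \<le> k} = (\<Union>l\<le>k. {\<alpha>. size \<alpha> = l})"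
    by auto
  then have fin': "finite {\<alpha> :: 'n multiset. size \<alpha> \<le> k}"
    using fin by simp
  have "{a :: 'n coord. coord_order a \<le> k} \<subseteq> insert Time (range Space) \<union>
      (\<lambda>(i, \<alpha>). Vel i \<alpha>) ` (UNIV \<times> {\<alpha>. size \<alpha> \<le> k}) \<union>
      Dens ` {\<alpha>. size \<alpha> \<le> k} \<union> Entr ` {\<alpha>. size \<alpha> \<le> k}"
  proof
    fix a :: "'n coord" assume "a \<in> {a. coord_order a \<le> k}"
    then show "a \<in> insert Time (range Space) \<union>
      (\<lambda>(i, \<alpha>). Vel i \<alpha>) ` (UNIV \<times> {\<alpha>. size \<alpha> \<le> k}) \<union>
      Dens ` {\<alpha>. size \<alpha> \<le> k} \<union> Entr ` {\<alpha>. size \<alpha> \<le> k}"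
      by (cases a) (auto simp: image_iff)
  qed
  then show ?thesis
    by (rule finite_subset) (simp add: fin')
qed

lemma open_jet_dom:
  fixes c :: "('m, 'n::finite) chart"
  assumes "open (chart_image c)"
  shows "open (jet_dom c)"
proof -
  have "continuous_on UNIV (pos :: 'n::finite jet \<Rightarrow> real^'n)"
    unfolding pos_def[abs_def]
    by (intro continuous_on_vec_lambda continuous_on_product_coordinates)
  moreover have "continuous_on UNIV (dens :: 'n::finite jet \<Rightarrow> real)"
    unfolding dens_def[abs_def] by (rule continuous_on_product_coordinates)
  ultimately have "open ((pos :: 'n::finite jet \<Rightarrow> real^'n) -` chart_image c \<inter> dens -` {0<..})"
    using assms by (intro open_Int open_vimage open_greaterThan)
  moreover have "pos -` chart_image c \<inter> dens -` {0<..} = jet_dom c"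
    by (auto simp: jet_dom_def)
  ultimately show ?thesis
    by simp
qed

lemma tendsto_fun_coordinatewise:
  fixes f :: "'b \<Rightarrow> 'c \<Rightarrow> real"
  assumes "\<And>a. ((\<lambda>y. f y a) \<longlongrightarrow> l a) F"
  shows "(f \<longlongrightarrow> l) F"
proof -
  have "limitin (product_topology (\<lambda>_. euclidean) UNIV) f l F"
    using assms by (simp add: limitin_componentwise)
  then show ?thesis
    by (simp add: euclidean_product_topology)
qed

lemma eventually_upd:
  fixes z :: "'c \<Rightarrow> real"
  assumes "open U" "z \<in> U"
  shows "\<forall>\<^sub>F s in nhds (z a). z(a := s) \<in> U"
proof -
  have "((\<lambda>s. z(a := s)) \<longlongrightarrow> z) (nhds (z a))"
  proof (rule tendsto_fun_coordinatewise)
    show "((\<lambda>s. (z(a := s)) b) \<longlongrightarrow> z b) (nhds (z a))" for b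
      by (cases "b = a") (auto simp: filterlim_ident)
  qed
  then show ?thesis
    using assms topological_tendstoD by blast
qed

lemma pd_eqI: "((\<lambda>s. F (z(a := s))) has_real_derivative D) (at (z a)) \<Longrightarrow> pd a F z = D"
  unfolding pd_def by (rule DERIV_imp_deriv)

text \<open>An open set contains all small changes of the coordinate \<open>a\<close>, and
  \<open>F\<close> does not see them.\<close>

lemma pd_outside:
  assumes "open U" "z \<in> U" "depends_only_on U C F" "a \<notin> C"
  shows "pd a F z = 0"
proof -
  have "pd a F z = pd a (\<lambda>w. F z) z"
    unfolding pd_def
  proof (rule deriv_cong_ev)
    show "\<forall>\<^sub>F s in nhds (z a). F (z(a := s)) = F z"
      using eventually_upd[OF assms(1,2), of a]
      by eventually_elim
        (use assms(2-4) in \<open>unfold depends_only_on_def, metis fun_upd_apply\<close>)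
  qed simp
  then show ?thesis
    by (simp add: pd_def)
qed

lemma pd_depends_only_on:
  assumes "open U" "depends_only_on U C F"
  shows "depends_only_on U C (pd a F)"
  unfolding depends_only_on_def
proof (intro ballI impI)
  fix z z' assume z: "z \<in> U" "z' \<in> U" "\<forall>a\<in>C. z a = z' a"
  show "pd a F z = pd a F z'"
  proof (cases "a \<in> C")
    case True
    then have za: "z a = z' a"
      using z by simp
    have "\<forall>\<^sub>F s in nhds (z' a). z(a := s) \<in> U"
      using eventually_upd[OF assms(1) z(1), of a] by (simp only: za)
    with eventually_upd[OF assms(1) z(2), of a]
    have "\<forall>\<^sub>F s in nhds (z' a). F (z(a := s)) = F (z'(a := s))"
    proof eventually_elim
      case (elim s)
      have "\<forall>b\<in>C. (z(a := s)) b = (z'(a := s)) b"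
        using z(3) by simp
      with elim assms(2) show ?case
        unfolding depends_only_on_def by blast
    qed
    then show ?thesis
      unfolding pd_def za by (rule deriv_cong_ev) simp
  next
    case False
    then show ?thesis
      using pd_outside[OF assms(1) z(1) assms(2)] pd_outside[OF assms(1) z(2) assms(2)] by simp
  qed
qed

text \<open>\<open>total_deriv\<close> sums over a set that varies with the function and the point.
  A fixed finite index set makes such sums comparable, and continuous in the point.\<close>

lemma total_deriv_eq_sum:
  assumes "finite N" "\<And>a. a \<notin> N \<Longrightarrow> pd a F z = 0"
  shows "total_deriv j F z = (\<Sum>a\<in>N. shift j z a * pd a F z)"
  unfolding total_deriv_def
  by (rule sum.mono_neutral_left) (use assms in auto)

section \<open>Differentiation along curves in jet space\<close>

lemma smooth_jet_has_derivative:
  assumes "smooth_jet U F" "z \<in> U"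
  shows "((\<lambda>s. F (z(a := s))) has_real_derivative pd a F z) (at (z a))"
proof -
  have "Ck_jet (Suc 0) U F"
    using assms(1) unfolding smooth_jet_def by blast
  then show ?thesis
    using assms(2) unfolding pd_def
    by (auto simp: DERIV_deriv_iff_real_differentiable)
qed

lemma smooth_jet_pd: "smooth_jet U F \<Longrightarrow> smooth_jet U (pd a F)"
  unfolding smooth_jet_def using Ck_jet.simps(2) by blast

lemma smooth_jet_continuous: "smooth_jet U F \<Longrightarrow> continuous_on U F"
  unfolding smooth_jet_def using Ck_jet.simps(1) by blast

text \<open>The mean value theorem without an order on the endpoints. In the chain rule
  \<open>b\<close> is a value of a curve and may lie on either side of \<open>a\<close> or equal
  it.\<close>

lemma mean_value_symmetric:
  fixes f :: "real \<Rightarrow> real"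
  assumes "\<And>x. \<bar>x - a\<bar> \<le> \<bar>b - a\<bar> \<Longrightarrow> (f has_real_derivative f' x) (at x)"
  shows "\<exists>\<xi>. \<bar>\<xi> - a\<bar> \<le> \<bar>b - a\<bar> \<and> f b - f a = (b - a) * f' \<xi>"
proof -
  consider "a = b" | "a < b" | "b < a" by linarith
  then show ?thesis
  proof cases
    case 2
    then obtain \<xi> where "a < \<xi>" "\<xi> < b" "f b - f a = (b - a) * f' \<xi>"
      using MVT2[OF 2, of f f'] assms by auto
    then show ?thesis
      by (intro exI[of _ \<xi>]) auto
  next
    case 3
    then obtain \<xi> where "b < \<xi>" "\<xi> < a" "f a - f b = (a - b) * f' \<xi>"
      using MVT2[OF 3, of f f'] assms by auto
    then show ?thesis
      by (intro exI[of _ \<xi>]) (auto simp: left_diff_distrib)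
  qed auto
qed

text \<open>Only separate partial derivatives are available, so the coordinates in \<open>D\<close>
  are released one at a time while the others stay frozen at time \<open>t\<close>. Releasing one
  more changes \<open>F\<close> by an increment that the mean value theorem expresses by
  \<open>pd a F\<close> at an intermediate point, and continuity of \<open>pd a F\<close> gives the
  limit.\<close>

lemma chain_rule_override:
  fixes \<gamma> :: "real \<Rightarrow> 'n coord \<Rightarrow> real"
  assumes U: "open U" "\<gamma> t \<in> U" and F: "smooth_jet U F" and D: "finite D"
    and \<gamma>: "\<And>a. a \<in> D \<Longrightarrow> ((\<lambda>\<tau>. \<gamma> \<tau> a) has_real_derivative \<gamma>' a) (at t)"
  shows "((\<lambda>\<tau>. F (\<lambda>a. if a \<in> D then \<gamma> \<tau> a else \<gamma> t a)) has_real_derivative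
           (\<Sum>a\<in>D. \<gamma>' a * pd a F (\<gamma> t))) (at t)"
  using D \<gamma>
proof (induction D rule: finite_induct)
  case (insert a D)
  define G where "G \<tau> = (\<lambda>b. if b \<in> D then \<gamma> \<tau> b else \<gamma> t b)" for \<tau>
  have G_t: "G t = \<gamma> t"
    by (auto simp: G_def)
  have G_a: "G \<tau> a = \<gamma> t a" for \<tau>
    using insert.hyps by (simp add: G_def)
  have G_lim: "((\<lambda>\<tau>. G \<tau> b) \<longlongrightarrow> \<gamma> t b) (nhds t)" for b
    using insert.prems[of b]
    by (cases "b \<in> D") (auto simp: G_def dest!: DERIV_isCont simp: isCont_def tendsto_nhds_iff)
  have \<gamma>_lim: "((\<lambda>\<tau>. \<gamma> \<tau> a) \<longlongrightarrow> \<gamma> t a) (at t)"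
    using insert.prems[of a] by (auto dest!: DERIV_isCont simp: isCont_def)
  \<comment> \<open>Letting time and the value at \<open>a\<close> vary independently gives a
    rectangle inside \<open>U\<close>, so that the whole segment used by the mean value theorem
    stays in \<open>U\<close>.\<close>
  have "((\<lambda>p. (G (fst p))(a := snd p)) \<longlongrightarrow> \<gamma> t) (nhds (t, \<gamma> t a))"
  proof (rule tendsto_fun_coordinatewise)
    fix b
    show "((\<lambda>p. ((G (fst p))(a := snd p)) b) \<longlongrightarrow> \<gamma> t b) (nhds (t, \<gamma> t a))"
    proof (cases "b = a")
      case True
      then show ?thesis
        using tendsto_snd[of "\<lambda>p. p" "(t, \<gamma> t a)" "nhds (t, \<gamma> t a)"] by (simp add: filterlim_ident)
    next
      case False
      have "filterlim fst (nhds t) (nhds (t, \<gamma> t a))"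
        using tendsto_fst[of "\<lambda>p. p" "(t, \<gamma> t a)" "nhds (t, \<gamma> t a)"] by (simp add: filterlim_ident)
      then show ?thesis
        using filterlim_compose[OF G_lim[of b]] False by simp
    qed
  qed
  then have "\<forall>\<^sub>F p in nhds (t, \<gamma> t a). (G (fst p))(a := snd p) \<in> U"
    using U topological_tendstoD by blast
  then obtain e where e: "e > 0" "\<And>p. dist p (t, \<gamma> t a) < e \<Longrightarrow> (G (fst p))(a := snd p) \<in> U"
    unfolding eventually_nhds_metric by blast
  have near: "\<forall>\<^sub>F \<tau> in at t. dist \<tau> t < e / 2 \<and> dist (\<gamma> \<tau> a) (\<gamma> t a) < e / 2"
    using e(1) tendstoD[OF \<gamma>_lim, of "e / 2"] tendstoD[OF tendsto_ident_at, of "e / 2" t UNIV]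
    by (auto intro: eventually_conj)
  have inU: "(G \<tau>)(a := \<sigma>) \<in> U" if "dist \<tau> t < e / 2" "dist \<sigma> (\<gamma> t a) < e / 2" for \<tau> \<sigma>
    using e(2)[of "(\<tau>, \<sigma>)"] that dist_Pair_Pair[of \<tau> \<sigma> t "\<gamma> t a"]
      sqrt_sum_squares_le_sum_abs[of "dist \<tau> t" "dist \<sigma> (\<gamma> t a)"] by simp
  have mvt: "\<exists>\<xi>. \<bar>\<xi> - \<gamma> t a\<bar> \<le> \<bar>\<gamma> \<tau> a - \<gamma> t a\<bar> \<and>
      F ((G \<tau>)(a := \<gamma> \<tau> a)) - F (G \<tau>) = (\<gamma> \<tau> a - \<gamma> t a) * pd a F ((G \<tau>)(a := \<xi>))"
    if \<tau>: "dist \<tau> t < e / 2 \<and> dist (\<gamma> \<tau> a) (\<gamma> t a) < e / 2" for \<tau>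
  proof -
    have d: "((\<lambda>s. F ((G \<tau>)(a := s))) has_real_derivative pd a F ((G \<tau>)(a := \<sigma>))) (at \<sigma>)"
      if "dist \<sigma> (\<gamma> t a) < e / 2" for \<sigma>
      using smooth_jet_has_derivative[OF F inU, of \<tau> \<sigma> a] \<tau> that by simp
    have GG: "(G \<tau>)(a := \<gamma> t a) = G \<tau>"
      using G_a[of \<tau>] by auto
    have "dist x (\<gamma> t a) < e / 2" if "\<bar>x - \<gamma> t a\<bar> \<le> \<bar>\<gamma> \<tau> a - \<gamma> t a\<bar>" for x
      using \<tau> that unfolding dist_real_def by linarith
    then show ?thesis
      using mean_value_symmetric[of "\<gamma> t a" "\<gamma> \<tau> a", OF d]
      by (simp only: GG)
  qed
  then obtain \<xi> where \<xi>: "\<And>\<tau>. dist \<tau> t < e / 2 \<and> dist (\<gamma> \<tau> a) (\<gamma> t a) < e / 2 \<Longrightarrow>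
      \<bar>\<xi> \<tau> - \<gamma> t a\<bar> \<le> \<bar>\<gamma> \<tau> a - \<gamma> t a\<bar> \<and>
      F ((G \<tau>)(a := \<gamma> \<tau> a)) - F (G \<tau>) = (\<gamma> \<tau> a - \<gamma> t a) * pd a F ((G \<tau>)(a := \<xi> \<tau>))"
    by metis
  have \<xi>_lim: "(\<xi> \<longlongrightarrow> \<gamma> t a) (at t)"
  proof (rule metric_tendsto_imp_tendsto[OF \<gamma>_lim])
    show "\<forall>\<^sub>F \<tau> in at t. dist (\<xi> \<tau>) (\<gamma> t a) \<le> dist (\<gamma> \<tau> a) (\<gamma> t a)"
      using near by eventually_elim (use \<xi> in \<open>auto simp: dist_real_def\<close>)
  qed
  \<comment> \<open>In the product topology coordinatewise convergence suffices, so the intermediate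
    points tend to \<open>\<gamma> t\<close>.\<close>
  have "((\<lambda>\<tau>. (G \<tau>)(a := \<xi> \<tau>)) \<longlongrightarrow> \<gamma> t) (at t)"
  proof (rule tendsto_fun_coordinatewise)
    show "((\<lambda>\<tau>. ((G \<tau>)(a := \<xi> \<tau>)) b) \<longlongrightarrow> \<gamma> t b) (at t)" for b
      using \<xi>_lim G_lim[of b] by (cases "b = a") (auto simp: tendsto_nhds_iff)
  qed
  then have pd_lim: "((\<lambda>\<tau>. pd a F ((G \<tau>)(a := \<xi> \<tau>))) \<longlongrightarrow> pd a F (\<gamma> t)) (at t)"
    using continuous_on_tendsto_compose[OF smooth_jet_continuous[OF smooth_jet_pd[OF F]]] U
      topological_tendstoD by blast
  have "((\<lambda>\<tau>. F ((G \<tau>)(a := \<gamma> \<tau> a)) - F (G \<tau>)) has_real_derivative \<gamma>' a * pd a F (\<gamma> t)) (at t)"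
    unfolding has_field_derivative_iff
  proof (rule Lim_transform_eventually)
    show "((\<lambda>\<tau>. (\<gamma> \<tau> a - \<gamma> t a) / (\<tau> - t) * pd a F ((G \<tau>)(a := \<xi> \<tau>))) \<longlongrightarrow> \<gamma>' a * pd a F (\<gamma> t)) (at t)"
      using insert.prems[of a] by (intro tendsto_mult pd_lim) (simp add: has_field_derivative_iff)
    have *: "F ((G t)(a := \<gamma> t a)) - F (G t) = 0"
      by (simp add: G_t)
    show "\<forall>\<^sub>F \<tau> in at t. (\<gamma> \<tau> a - \<gamma> t a) / (\<tau> - t) * pd a F ((G \<tau>)(a := \<xi> \<tau>)) =
        (F ((G \<tau>)(a := \<gamma> \<tau> a)) - F (G \<tau>) - (F ((G t)(a := \<gamma> t a)) - F (G t))) / (\<tau> - t)"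
      unfolding * using near by eventually_elim (simp add: \<xi>)
  qed
  moreover have "((\<lambda>\<tau>. F (G \<tau>)) has_real_derivative (\<Sum>a\<in>D. \<gamma>' a * pd a F (\<gamma> t))) (at t)"
    unfolding G_def using insert.IH insert.prems by simp
  ultimately have "((\<lambda>\<tau>. F (G \<tau>) + (F ((G \<tau>)(a := \<gamma> \<tau> a)) - F (G \<tau>))) has_real_derivative
      (\<Sum>a\<in>D. \<gamma>' a * pd a F (\<gamma> t)) + \<gamma>' a * pd a F (\<gamma> t)) (at t)"
    using DERIV_add by blast
  moreover have "(G \<tau>)(a := \<gamma> \<tau> a) = (\<lambda>b. if b \<in> insert a D then \<gamma> \<tau> b else \<gamma> t b)" for \<tau>
    by (auto simp: G_def)
  ultimately show ?case
    using insert.hyps by (simp add: add.commute cong: if_cong)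
qed simp

text \<open>Freezing the coordinates outside \<open>D\<close> does not change \<open>F\<close> as
  long as both curves stay in \<open>U\<close>. So the curve may move arbitrarily within
  \<open>U\<close> in the infinitely many other coordinates.\<close>

lemma chain_rule_jet:
  fixes \<gamma> :: "real \<Rightarrow> 'n coord \<Rightarrow> real"
  assumes U: "open U" "\<gamma> t \<in> U" "\<forall>\<^sub>F \<tau> in nhds t. \<gamma> \<tau> \<in> U" and F: "smooth_jet U F"
    and D: "finite D" "depends_only_on U D F"
    and \<gamma>: "\<And>a. a \<in> D \<Longrightarrow> ((\<lambda>\<tau>. \<gamma> \<tau> a) has_real_derivative \<gamma>' a) (at t)"
  shows "((\<lambda>\<tau>. F (\<gamma> \<tau>)) has_real_derivative (\<Sum>a\<in>D. \<gamma>' a * pd a F (\<gamma> t))) (at t)"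
proof -
  define G where "G \<tau> = (\<lambda>b. if b \<in> D then \<gamma> \<tau> b else \<gamma> t b)" for \<tau>
  have "(G \<longlongrightarrow> \<gamma> t) (nhds t)"
  proof (rule tendsto_fun_coordinatewise)
    show "((\<lambda>\<tau>. G \<tau> a) \<longlongrightarrow> \<gamma> t a) (nhds t)" for a
      using DERIV_isCont[OF \<gamma>, of a]
      by (cases "a \<in> D") (auto simp: G_def isCont_def tendsto_nhds_iff)
  qed
  then have "\<forall>\<^sub>F \<tau> in nhds t. G \<tau> \<in> U"
    using U topological_tendstoD by blast
  with U(3) have "\<forall>\<^sub>F \<tau> in nhds t. F (\<gamma> \<tau>) = F (G \<tau>)"
  proof eventually_elim
    case (elim \<tau>)
    have "\<forall>a\<in>D. \<gamma> \<tau> a = G \<tau> a"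
      by (simp add: G_def)
    with elim D(2) show ?case
      unfolding depends_only_on_def by blast
  qed
  moreover have "((\<lambda>\<tau>. F (G \<tau>)) has_real_derivative (\<Sum>a\<in>D. \<gamma>' a * pd a F (\<gamma> t))) (at t)"
    using chain_rule_override[OF U(1,2) F D(1) \<gamma>] unfolding G_def by blast
  ultimately show ?thesis
    using DERIV_cong_ev[OF refl, of "\<lambda>\<tau>. F (\<gamma> \<tau>)" "\<lambda>\<tau>. F (G \<tau>)" t] by blast
qed


section \<open>The Riemannian volume factor\<close>

lemma matrix_inv_right_left:
  assumes "invertible A"
  shows "A ** matrix_inv A = mat 1" "matrix_inv A ** A = mat 1"
  using someI_ex[OF assms[unfolded invertible_def]] unfolding matrix_inv_def by auto

lemma matrix_inv_symmetric:
  fixes A :: "real^'n^'n"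
  assumes "invertible A" "transpose A = A"
  shows "transpose (matrix_inv A) = matrix_inv A"
proof -
  have "transpose (matrix_inv A) ** A = mat 1"
    using matrix_inv_right_left(1)[OF assms(1)] assms(2)
    by (metis matrix_transpose_mul transpose_mat)
  then show ?thesis
    by (metis matrix_inv_right_left(1)[OF assms(1)] matrix_mul_assoc matrix_mul_lid matrix_mul_rid)
qed

text \<open>Cramer's rule for the columns of the inverse: every entry is a quotient of polynomials
  in the entries of \<open>A\<close>, from which continuity of the inverse follows.\<close>

lemma matrix_inv_cramer:
  fixes A :: "real^'n^'n"
  assumes "invertible A"
  shows "matrix_inv A $ k $ l = det (\<chi> i j. if j = k then axis l 1 $ i else A $ i $ j) / det A"
proof -
  have "A *v (matrix_inv A *v axis l 1) = axis l 1"
    by (simp add: matrix_vector_mul_assoc matrix_inv_right_left[OF assms])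
  then have "matrix_inv A *v axis l 1 =
      (\<chi> k. det (\<chi> i j. if j = k then axis l 1 $ i else A $ i $ j) / det A)"
    using cramer[of A] assms by (simp add: invertible_det_nz)
  moreover have "(matrix_inv A *v axis l 1) $ k = matrix_inv A $ k $ l"
    by (simp add: matrix_vector_mult_basis column_def)
  ultimately show ?thesis
    by simp
qed

lemma continuous_on_det:
  fixes A :: "'a::topological_space \<Rightarrow> real^'n^'n"
  assumes "\<And>i j. continuous_on S (\<lambda>x. A x $ i $ j)"
  shows "continuous_on S (\<lambda>x. det (A x))"
  unfolding det_def by (intro continuous_intros assms)

lemma continuous_on_matrix_inv:
  fixes A :: "'a::topological_space \<Rightarrow> real^'n^'n"
  assumes "\<And>i j. continuous_on S (\<lambda>x. A x $ i $ j)" "\<And>x. x \<in> S \<Longrightarrow> invertible (A x)"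
  shows "continuous_on S (\<lambda>x. matrix_inv (A x) $ k $ l)"
proof -
  have "continuous_on S (\<lambda>x. if j = k then axis l 1 $ i else A x $ i $ j)" for i j
    using assms(1) by (cases "j = k") auto
  then have "continuous_on S
      (\<lambda>x. det (\<chi> i j. if j = k then axis l 1 $ i else A x $ i $ j) / det (A x))"
    using assms by (intro continuous_on_divide continuous_on_det) (auto simp: invertible_det_nz)
  then show ?thesis
    using matrix_inv_cramer[OF assms(2)] by (simp cong: continuous_on_cong)
qed

lemma det_has_derivative_rows:
  fixes A :: "real \<Rightarrow> real^'n^'n"
  assumes "\<And>i j. ((\<lambda>\<tau>. A \<tau> $ i $ j) has_real_derivative A' $ i $ j) (at t)"
  shows "((\<lambda>\<tau>. det (A \<tau>)) has_real_derivative
           (\<Sum>k\<in>UNIV. det (\<chi> i. if i = k then A' $ k else A t $ i))) (at t)"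
proof -
  let ?P = "{p. p permutes (UNIV :: 'n set)}"
  have row: "(\<Prod>i\<in>UNIV. (\<chi> i. if i = k then A' $ k else A t $ i) $ i $ p i) =
      A' $ k $ p k * (\<Prod>i\<in>UNIV - {k}. A t $ i $ p i)" for k p
    by (subst prod.remove[of _ k]) (auto intro!: prod.cong)
  have "((\<lambda>\<tau>. \<Sum>p\<in>?P. of_int (sign p) * (\<Prod>i\<in>UNIV. A \<tau> $ i $ p i)) has_real_derivative
      (\<Sum>p\<in>?P. of_int (sign p) * (\<Sum>k\<in>UNIV. A' $ k $ p k * (\<Prod>i\<in>UNIV - {k}. A t $ i $ p i)))) (at t)"
    by (intro DERIV_sum DERIV_cmult has_field_derivative_prod assms)
  also have "(\<Sum>p\<in>?P. of_int (sign p) * (\<Sum>k\<in>UNIV. A' $ k $ p k * (\<Prod>i\<in>UNIV - {k}. A t $ i $ p i))) =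
      (\<Sum>k\<in>UNIV. \<Sum>p\<in>?P. of_int (sign p) * (A' $ k $ p k * (\<Prod>i\<in>UNIV - {k}. A t $ i $ p i)))"
    unfolding sum_distrib_left by (rule sum.swap)
  finally show ?thesis
    unfolding det_def row .
qed

text \<open>Jacobi's formula. The rows of \<open>A'\<close> are combined from the rows of
  \<open>A t\<close> with the coefficients in \<open>A' ** matrix_inv (A t)\<close>; replacing row
  \<open>k\<close> by such a combination multiplies the determinant by the \<open>k\<close>-th
  diagonal coefficient, and these add up to a trace.\<close>

lemma det_has_derivative:
  fixes A :: "real \<Rightarrow> real^'n^'n"
  assumes "\<And>i j. ((\<lambda>\<tau>. A \<tau> $ i $ j) has_real_derivative A' $ i $ j) (at t)"
    and inv: "invertible (A t)"
  shows "((\<lambda>\<tau>. det (A \<tau>)) has_real_derivative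
           det (A t) * (\<Sum>k\<in>UNIV. \<Sum>l\<in>UNIV. matrix_inv (A t) $ k $ l * A' $ l $ k)) (at t)"
proof -
  define X where "X = A' ** matrix_inv (A t)"
  have row: "A' $ k = (\<Sum>i\<in>UNIV. X $ k $ i *s row i (A t))" for k
  proof -
    have "A' = X ** A t"
      by (simp add: X_def matrix_mul_assoc[symmetric] matrix_inv_right_left[OF inv])
    then show ?thesis
      by (simp add: vec_eq_iff matrix_matrix_mult_def row_def)
  qed
  have "det (\<chi> i. if i = k then A' $ k else A t $ i) = X $ k $ k * det (A t)" for k
  proof -
    have "row i (A t) = A t $ i" for i
      by (simp add: row_def)
    then show ?thesis
      using cramer_lemma_transpose[of k "X $ k" "A t"] unfolding row[symmetric] by (simp only:)
  qed
  then have "(\<Sum>k\<in>UNIV. det (\<chi> i. if i = k then A' $ k else A t $ i)) = (\<Sum>k\<in>UNIV. X $ k $ k) * det (A t)"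
    by (simp add: sum_distrib_right)
  also have "(\<Sum>k\<in>UNIV. X $ k $ k) = (\<Sum>k\<in>UNIV. \<Sum>l\<in>UNIV. matrix_inv (A t) $ k $ l * A' $ l $ k)"
    unfolding X_def matrix_matrix_mult_def by (subst sum.swap) (simp add: mult.commute)
  finally show ?thesis
    using det_has_derivative_rows[OF assms(1)] by (simp add: mult.commute)
qed

section \<open>Metric and volume factor in a chart\<close>

lemma partial_has_derivative:
  assumes "f differentiable (at x)"
  shows "((\<lambda>\<tau>. f (x + \<tau> *\<^sub>R axis i 1)) has_real_derivative partial i f x) (at 0)"
proof -
  have "(f has_derivative frechet_derivative f (at x)) (at (x + 0 *\<^sub>R axis i 1))"
    using assms by (simp add: frechet_derivative_works)
  then have "((\<lambda>\<tau>. f (x + \<tau> *\<^sub>R axis i 1)) has_derivative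
      (\<lambda>\<tau>. frechet_derivative f (at x) (\<tau> *\<^sub>R axis i 1))) (at 0)"
    by (intro has_derivative_compose[where g = f and f = "\<lambda>\<tau>. x + \<tau> *\<^sub>R axis i 1"])
      (auto intro!: derivative_eq_intros)
  moreover have "linear (frechet_derivative f (at x))"
    using assms linear_frechet_derivative by blast
  ultimately show ?thesis
    by (intro has_derivative_imp_has_field_derivative) (auto simp: partial_def linear_scale)
qed

lemma partial_cong:
  assumes "open U" "x \<in> U" "\<And>y. y \<in> U \<Longrightarrow> f y = g y"
  shows "partial i f x = partial i g x"
proof -
  have "(f has_derivative F) (at x) \<longleftrightarrow> (g has_derivative F) (at x)" for F
  proof
    show "(g has_derivative F) (at x)" if "(f has_derivative F) (at x)"
      using that assms by (rule has_derivative_transform_within_open)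
    show "(f has_derivative F) (at x)" if "(g has_derivative F) (at x)"
      using that assms(1,2) by (rule has_derivative_transform_within_open) (simp add: assms(3))
  qed
  then show ?thesis
    unfolding partial_def frechet_derivative_def by simp
qed

lemma smooth_on_differentiable:
  assumes "smooth_on U f" "open U" "x \<in> U"
  shows "f differentiable (at x)"
proof -
  have "Ck_on (Suc 0) U f"
    using assms(1) unfolding smooth_on_def by blast
  then have "f differentiable_on U"
    by (simp only: Ck_on.simps(2))
  then show ?thesis
    using assms(2,3) differentiable_on_eq_differentiable_at by blast
qed

lemma smooth_on_partial: "smooth_on U f \<Longrightarrow> smooth_on U (partial i f)"
  unfolding smooth_on_def using Ck_on.simps(2) by blast

lemma smooth_on_continuous: "smooth_on U f \<Longrightarrow> continuous_on U f"
  unfolding smooth_on_def using Ck_on.simps(1) by blast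

text \<open>The conditions that \<open>riemannian_metric\<close> puts on a single chart, without the
  transformation law; divergences are studied inside one chart.\<close>

definition metric_on :: "(real^'n::finite) set \<Rightarrow> (real^'n \<Rightarrow> real^'n^'n) \<Rightarrow> bool" where
  "metric_on U h \<longleftrightarrow> (\<forall>i j. smooth_on U (\<lambda>x. h x $ i $ j)) \<and>
     (\<forall>x\<in>U. transpose (h x) = h x \<and> (\<forall>v. v \<noteq> 0 \<longrightarrow> v \<bullet> (h x *v v) > 0))"

lemma metric_on_invertible:
  assumes "metric_on U h" "x \<in> U"
  shows "invertible (h x)"
proof -
  have "v = 0" if "h x *v v = 0" for v
    using assms that unfolding metric_on_def by (metis inner_zero_right less_irrefl)
  then show ?thesis
    using matrix_left_invertible_ker[of "h x"] invertible_left_inverse[of "h x"] by metis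
qed

lemma continuous_on_christoffel:
  assumes "metric_on U h"
  shows "continuous_on U (\<lambda>x. christoffel h x k i j)"
  unfolding christoffel_def
  by (intro continuous_intros continuous_on_matrix_inv smooth_on_continuous smooth_on_partial)
    (use assms metric_on_invertible in \<open>auto simp: metric_on_def\<close>)

text \<open>The absolute value spares the proof that a positive definite matrix has positive determinant.\<close>

definition volume_factor :: "(real^'n \<Rightarrow> real^'n^'n) \<Rightarrow> real^'n::finite \<Rightarrow> real" where
  "volume_factor h x = sqrt \<bar>det (h x)\<bar>"

lemma volume_factor_pos:
  "metric_on U h \<Longrightarrow> x \<in> U \<Longrightarrow> volume_factor h x > 0"
  using metric_on_invertible[of U h x] by (simp add: volume_factor_def invertible_det_nz)

lemma continuous_on_volume_factor:
  "metric_on U h \<Longrightarrow> continuous_on U (volume_factor h)"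
  unfolding volume_factor_def[abs_def] metric_on_def
  by (intro continuous_intros continuous_on_det smooth_on_continuous) blast

text \<open>In the trace, exchanging the two summation indices matches the first and the third
  derivative term with opposite signs, by symmetry of the metric and its inverse. The index order of
  the surviving term is that of Jacobi's formula.\<close>

lemma christoffel_contraction:
  assumes "metric_on U h" "open U" "x \<in> U"
  shows "(\<Sum>i\<in>UNIV. christoffel h x i i j) =
    (\<Sum>i\<in>UNIV. \<Sum>l\<in>UNIV. matrix_inv (h x) $ i $ l * partial j (\<lambda>y. h y $ l $ i) x) / 2"
proof -
  have swap: "A $ k $ l = A $ l $ k" if "transpose A = A" for A :: "real^'n^'n" and k l
    using arg_cong[OF that, of "\<lambda>B. B $ l $ k"] by (simp add: transpose_def)
  have h_sym: "transpose (h y) = h y" if "y \<in> U" for y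
    using assms(1) that unfolding metric_on_def by blast
  define G where "G = matrix_inv (h x)"
  define dh where "dh i k l = partial i (\<lambda>y. h y $ k $ l) x" for i k l
  have G_sym: "G $ k $ l = G $ l $ k" for k l
    unfolding G_def
    by (rule swap[OF matrix_inv_symmetric[OF metric_on_invertible[OF assms(1,3)] h_sym[OF assms(3)]]])
  have dh_sym: "dh i k l = dh i l k" for i k l
    unfolding dh_def by (rule partial_cong[OF assms(2,3)]) (rule swap[OF h_sym])
  have "(\<Sum>i\<in>UNIV. \<Sum>l\<in>UNIV. G $ i $ l * dh i j l) = (\<Sum>l\<in>UNIV. \<Sum>i\<in>UNIV. G $ i $ l * dh i j l)"
    by (rule sum.swap)
  also have "\<dots> = (\<Sum>i\<in>UNIV. \<Sum>l\<in>UNIV. G $ i $ l * dh l i j)"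
    by (intro sum.cong refl arg_cong2[where f = "(*)"] G_sym dh_sym)
  finally have cancel: "(\<Sum>i\<in>UNIV. \<Sum>l\<in>UNIV. G $ i $ l * dh i j l) =
      (\<Sum>i\<in>UNIV. \<Sum>l\<in>UNIV. G $ i $ l * dh l i j)" .
  have "(\<Sum>i\<in>UNIV. christoffel h x i i j) =
      (\<Sum>i\<in>UNIV. \<Sum>l\<in>UNIV. G $ i $ l * (dh i j l + dh j i l - dh l i j)) / 2"
    unfolding christoffel_def G_def dh_def by (rule sum_divide_distrib[symmetric])
  also have "\<dots> = (\<Sum>i\<in>UNIV. \<Sum>l\<in>UNIV. G $ i $ l * dh j i l) / 2"
    unfolding distrib_left right_diff_distrib sum.distrib sum_subtractf cancel by simp
  also have "\<dots> = (\<Sum>i\<in>UNIV. \<Sum>l\<in>UNIV. G $ i $ l * dh j l i) / 2"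
    by (intro arg_cong2[where f = "(/)"] sum.cong refl arg_cong2[where f = "(*)"] dh_sym)
  finally show ?thesis
    unfolding G_def dh_def .
qed

text \<open>By Jacobi's formula the logarithmic derivative of sqrt |det h| is the contracted
  Christoffel symbol. Hence \<open>volume_factor h\<close> times \<open>Div h X\<close> is the
  coordinate divergence of the weighted components, which can be integrated.\<close>

lemma volume_factor_has_derivative:
  assumes "metric_on U h" "open U" "x \<in> U"
  shows "((\<lambda>\<tau>. volume_factor h (x + \<tau> *\<^sub>R axis j 1)) has_real_derivative
           volume_factor h x * (\<Sum>i\<in>UNIV. christoffel h x i i j)) (at 0)"
proof -
  define T where "T = (\<Sum>i\<in>UNIV. \<Sum>l\<in>UNIV. matrix_inv (h x) $ i $ l * partial j (\<lambda>y. h y $ l $ i) x)"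
  have nz: "det (h x) \<noteq> 0"
    using metric_on_invertible[OF assms(1,3)] by (simp add: invertible_det_nz)
  have "((\<lambda>\<tau>. h (x + \<tau> *\<^sub>R axis j 1) $ i $ l) has_real_derivative
      partial j (\<lambda>y. h y $ i $ l) x) (at 0)" for i l
  proof (rule partial_has_derivative)
    show "(\<lambda>y. h y $ i $ l) differentiable (at x)"
      by (rule smooth_on_differentiable[OF _ assms(2,3)]) (use assms(1) in \<open>simp add: metric_on_def\<close>)
  qed
  then have "((\<lambda>\<tau>. h (x + \<tau> *\<^sub>R axis j 1) $ i $ l) has_real_derivative
      (\<chi> i l. partial j (\<lambda>y. h y $ i $ l) x) $ i $ l) (at 0)" for i l
    by simp
  from det_has_derivative[of "\<lambda>\<tau>. h (x + \<tau> *\<^sub>R axis j 1)"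
      "\<chi> i l. partial j (\<lambda>y. h y $ i $ l) x" 0, OF this]
  have det: "((\<lambda>\<tau>. det (h (x + \<tau> *\<^sub>R axis j 1))) has_real_derivative det (h x) * T) (at 0)"
    using metric_on_invertible[OF assms(1,3)] by (simp add: T_def)
  \<comment> \<open>Both signs of \<open>d\<close> lead to the same expression for the
    derivative.\<close>
  have "((\<lambda>d. sqrt \<bar>d\<bar>) has_real_derivative sqrt \<bar>d\<bar> / (2 * d)) (at d)" if "d \<noteq> 0" for d :: real
  proof (cases "d > 0")
    case True
    have "(sqrt has_real_derivative inverse (sqrt d) / 2) (at d)"
      using True by (rule DERIV_real_sqrt)
    moreover have "inverse (sqrt d) / 2 = sqrt \<bar>d\<bar> / (2 * d)"
      using True sqrt_divide_self_eq[of d] by simp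
    ultimately have "(sqrt has_real_derivative sqrt \<bar>d\<bar> / (2 * d)) (at d)"
      by simp
    then show ?thesis
      by (rule has_field_derivative_transform_within_open[where S = "{0<..}"]) (use True in auto)
  next
    case False
    then have d: "d < 0"
      using that by simp
    have "((\<lambda>d. sqrt (- d)) has_real_derivative inverse (sqrt (- d)) / 2 * (- 1)) (at d)"
      by (rule DERIV_chain2[OF DERIV_real_sqrt DERIV_minus[OF DERIV_ident]]) (use d in simp)
    moreover have "inverse (sqrt (- d)) / 2 * (- 1) = sqrt \<bar>d\<bar> / (2 * d)"
      using d sqrt_divide_self_eq[of "- d"] by simp
    ultimately have "((\<lambda>d. sqrt (- d)) has_real_derivative sqrt \<bar>d\<bar> / (2 * d)) (at d)"
      by simp
    then show ?thesis
      by (rule has_field_derivative_transform_within_open[where S = "{..<0}"]) (use d in auto)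
  qed
  then have "((\<lambda>d. sqrt \<bar>d\<bar>) has_real_derivative sqrt \<bar>det (h x)\<bar> / (2 * det (h x)))
      (at (det (h (x + 0 *\<^sub>R axis j 1))))"
    using nz by simp
  from DERIV_chain2[where f = "\<lambda>d. sqrt \<bar>d\<bar>" and g = "\<lambda>\<tau>. det (h (x + \<tau> *\<^sub>R axis j 1))",
      OF this det]
  have "((\<lambda>\<tau>. sqrt \<bar>det (h (x + \<tau> *\<^sub>R axis j 1))\<bar>) has_real_derivative
      sqrt \<bar>det (h x)\<bar> / (2 * det (h x)) * (det (h x) * T)) (at 0)" .
  moreover have "sqrt \<bar>det (h x)\<bar> / (2 * det (h x)) * (det (h x) * T) = sqrt \<bar>det (h x)\<bar> * (T / 2)"
    using nz by simp
  ultimately show ?thesis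
    unfolding volume_factor_def christoffel_contraction[OF assms] T_def[symmetric] by (simp only:)
qed

section \<open>Total divergences and integration\<close>

lemma integrable_continuous_bounded_support:
  fixes Y :: "'a::euclidean_space \<Rightarrow> real"
  assumes "continuous_on UNIV Y" "bounded K" "\<And>x. x \<notin> K \<Longrightarrow> Y x = 0"
  shows "integrable lborel Y"
proof -
  obtain R where R: "\<And>x. x \<in> K \<Longrightarrow> norm x \<le> R"
    using assms(2) unfolding bounded_iff by blast
  have "integrable lborel (\<lambda>x. indicator (cball 0 R) x *\<^sub>R Y x)"
    using borel_integrable_compact[of "cball 0 R" Y] assms(1)
    by (auto intro: continuous_on_subset)
  moreover have "(\<lambda>x. indicator (cball 0 R) x *\<^sub>R Y x) = Y"
    using R assms(3) by (fastforce simp: indicator_def)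
  ultimately show ?thesis
    by simp
qed

text \<open>Translation invariance of Lebesgue measure makes every difference quotient integrate to
  0, and dominated convergence passes this on to the derivative. Iterated integrals are
  avoided.\<close>

lemma integral_directional_derivative_eq_0:
  fixes Y D :: "'a::euclidean_space \<Rightarrow> real"
  assumes deriv: "\<And>x. ((\<lambda>\<tau>. Y (x + \<tau> *\<^sub>R e)) has_real_derivative D x) (at 0)"
    and cont: "continuous_on UNIV Y" "continuous_on UNIV D"
    and supp: "bounded K" "\<And>x. x \<notin> K \<Longrightarrow> Y x = 0" "\<And>x. x \<notin> K \<Longrightarrow> D x = 0"
  shows "integral\<^sup>L lborel D = 0"
proof -
  obtain R where R: "\<And>x. x \<in> K \<Longrightarrow> norm x \<le> R"
    using supp(1) unfolding bounded_iff by blast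
  \<comment> \<open>The multiples of \<open>e\<close> in use have factor at most 1, so a translate
    can enter \<open>cball 0 R\<close> only from within \<open>C\<close>.\<close>
  define C where "C = cball (0::'a) (R + norm e)"
  have "compact (D ` cball 0 R)"
    using cont(2) by (intro compact_continuous_image) (auto intro: continuous_on_subset)
  then have "bounded (D ` cball 0 R)"
    by (rule compact_imp_bounded)
  then obtain B where B: "\<And>x. x \<in> cball 0 R \<Longrightarrow> \<bar>D x\<bar> \<le> B"
    unfolding bounded_iff real_norm_def by blast
  \<comment> \<open>\<open>cball 0 R\<close> is empty for negative \<open>R\<close>, and then
    \<open>B\<close> may be negative; the dominating bound must not be.\<close>
  define B' where "B' = \<bar>B\<bar>"
  have B': "\<bar>D x\<bar> \<le> B'" for x
  proof (cases "x \<in> K")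
    case True
    then show ?thesis
      using R[of x] B[of x] unfolding B'_def by auto
  qed (auto simp: supp B'_def)
  have deriv': "((\<lambda>\<tau>. Y (x + \<tau> *\<^sub>R e)) has_real_derivative D (x + t *\<^sub>R e)) (at t)" for x t
    using deriv[of "x + t *\<^sub>R e"] DERIV_shift[of "\<lambda>\<tau>. Y (x + \<tau> *\<^sub>R e)" "D (x + t *\<^sub>R e)" 0 t]
    by (simp add: algebra_simps)
  define g where "g m x = (Y (x + inverse (real (Suc m)) *\<^sub>R e) - Y x) * real (Suc m)" for m x
  have Y_int: "integrable lborel Y"
    by (rule integrable_continuous_bounded_support[OF cont(1) supp(1,2)])
  have meas: "Y \<in> borel_measurable borel" "D \<in> borel_measurable borel"
    using cont borel_measurable_continuous_onI by blast+
  have shift: "integral\<^sup>L lborel (\<lambda>x. Y (x + v)) = integral\<^sup>L lborel Y"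
    "integrable lborel (\<lambda>x. Y (x + v))" for v
    using integral_distr[of "(+) v" lborel borel Y] integrable_distr[of "(+) v" lborel borel Y]
      meas Y_int lborel_distr_plus[of v] by (simp_all add: add.commute)
  have g_int: "integral\<^sup>L lborel (g m) = 0" for m
    unfolding g_def using shift Y_int by simp
  have "(\<lambda>m. integral\<^sup>L lborel (g m)) \<longlonglongrightarrow> integral\<^sup>L lborel D"
  proof (rule integral_dominated_convergence)
    show "D \<in> borel_measurable lborel" "g m \<in> borel_measurable lborel" for m
      using meas unfolding g_def by (auto)
    show "integrable lborel (\<lambda>x. B' * indicator C x)"
      unfolding C_def by (intro integrable_mult_right integrable_real_indicator) (use emeasure_bounded_finite[OF bounded_cball] in \<open>auto simp: less_top\<close>)
    show "AE x in lborel. (\<lambda>m. g m x) \<longlonglongrightarrow> D x"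
    proof (rule AE_I2)
      fix x
      have "((\<lambda>\<tau>. (Y (x + \<tau> *\<^sub>R e) - Y x) / \<tau>) \<longlongrightarrow> D x) (at 0)"
        using deriv[of x] by (simp add: has_field_derivative_iff)
      moreover have "filterlim (\<lambda>m. inverse (real (Suc m))) (at 0) sequentially"
        unfolding filterlim_at using LIMSEQ_inverse_real_of_nat by simp
      ultimately have "(\<lambda>m. (Y (x + inverse (real (Suc m)) *\<^sub>R e) - Y x) / inverse (real (Suc m))) \<longlonglongrightarrow> D x"
        by (rule filterlim_compose)
      then show "(\<lambda>m. g m x) \<longlonglongrightarrow> D x"
        by (simp add: g_def divide_inverse)
    qed
    show "AE x in lborel. norm (g m x) \<le> B' * indicator C x" for m
    proof (rule AE_I2)
      fix x
      define \<epsilon> where "\<epsilon> = inverse (real (Suc m))"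
      have \<epsilon>: "0 < \<epsilon>" "\<epsilon> \<le> 1" "\<epsilon> * real (Suc m) = 1"
        unfolding \<epsilon>_def by (auto simp: inverse_le_1_iff)
      show "norm (g m x) \<le> B' * indicator C x"
      proof (cases "x \<in> C")
        case True
        obtain \<xi> where "Y (x + \<epsilon> *\<^sub>R e) - Y (x + 0 *\<^sub>R e) = (\<epsilon> - 0) * D (x + \<xi> *\<^sub>R e)"
          using MVT2[OF \<epsilon>(1), of "\<lambda>\<tau>. Y (x + \<tau> *\<^sub>R e)" "\<lambda>\<tau>. D (x + \<tau> *\<^sub>R e)"] deriv' by blast
        then have "g m x = D (x + \<xi> *\<^sub>R e) * (\<epsilon> * real (Suc m))"
          unfolding g_def \<epsilon>_def[symmetric] by simp
        then show ?thesis
          using \<epsilon>(3) B' True by simp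
      next
        case False
        have "norm (\<epsilon> *\<^sub>R e) \<le> norm e"
          using \<epsilon> mult_right_mono[of \<epsilon> 1 "norm e"] by simp
        then have "norm (x + \<epsilon> *\<^sub>R e) > R"
          using False norm_triangle_ineq4[of "x + \<epsilon> *\<^sub>R e" "\<epsilon> *\<^sub>R e"] unfolding C_def by simp
        moreover have "norm x > R"
        proof -
          have "norm x > R + norm e"
            using False unfolding C_def by simp
          then show ?thesis
            using norm_ge_zero[of e] by linarith
        qed
        ultimately have "Y x = 0" "Y (x + \<epsilon> *\<^sub>R e) = 0"
          using R supp(2) by (metis not_le)+
        then show ?thesis
          using False unfolding g_def \<epsilon>_def[symmetric] by simp
      qed
    qed
  qed
  then show ?thesis
    using g_int LIMSEQ_unique[OF _ tendsto_const] by simp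
qed

section \<open>Bump functions with finitely many derivatives\<close>

lemma max_power_has_derivative:
  fixes v :: real
  assumes "k \<ge> 2"
  shows "((\<lambda>v. max 0 v ^ k) has_real_derivative real k * max 0 v ^ (k - 1)) (at v)"
proof -
  consider "v > 0" | "v < 0" | "v = 0" by linarith
  then show ?thesis
  proof cases
    case 1
    have "((\<lambda>v. v ^ k) has_real_derivative real k * max 0 v ^ (k - 1)) (at v)"
      using 1 by (auto intro!: derivative_eq_intros)
    then show ?thesis
      by (rule has_field_derivative_transform_within_open[where S = "{0<..}"]) (use 1 in auto)
  next
    case 2
    have "((\<lambda>v. 0) has_real_derivative real k * max 0 v ^ (k - 1)) (at v)"
      using 2 assms by (auto intro!: derivative_eq_intros)
    then show ?thesis
      by (rule has_field_derivative_transform_within_open[where S = "{..<0}"]) (use 2 assms in auto)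
  next
    \<comment> \<open>At the corner the difference quotient is itself a truncated power with
      positive exponent, so it tends to 0.\<close>
    case 3
    have lim: "((\<lambda>v::real. max 0 v ^ (k - 1)) \<longlongrightarrow> max 0 0 ^ (k - 1)) (at 0)"
      by (intro tendsto_intros)
    have "((\<lambda>v::real. max 0 v ^ k / v) \<longlongrightarrow> 0) (at 0)"
    proof (rule Lim_transform_eventually)
      show "((\<lambda>v::real. max 0 v ^ (k - 1)) \<longlongrightarrow> 0) (at 0)"
        using lim assms by (simp add: power_0_left)
      have "max 0 v ^ (k - 1) = max 0 v ^ k / v" for v :: real
        using assms by (cases k) (auto simp: max_def)
      then show "\<forall>\<^sub>F v::real in at 0. max 0 v ^ (k - 1) = max 0 v ^ k / v"
        by simp
    qed
    then show ?thesis
      using 3 assms by (simp add: has_field_derivative_iff power_0_left)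
  qed
qed

text \<open>A truncated power of d^2 - y^2 has explicit derivatives up to order \<open>M\<close>: a
  polynomial times a lower truncated power. This is all that a flux of finite order can
  detect.\<close>

lemma flat_bump:
  fixes d :: real and M :: nat
  assumes "d > 0"
  obtains p :: "nat \<Rightarrow> real \<Rightarrow> real"
  where "\<And>m y. m < M \<Longrightarrow> (p m has_real_derivative p (Suc m) y) (at y)"
    and "\<And>m. continuous_on UNIV (p m)"
    and "\<And>m y. m \<le> M \<Longrightarrow> \<bar>y\<bar> \<ge> d \<Longrightarrow> p m y = 0"
    and "\<And>y. p 0 y \<ge> 0" and "p 0 0 > 0"
proof -
  \<comment> \<open>This leaves exponent \<open>N - m\<close> at least 2 where \<open>p m\<close> is
    differentiated and at least 1 where it must vanish for
    \<open>\<bar>y\<bar> \<ge> d\<close>.\<close>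
  define N where "N = M + 1"
  define r where "r = rec_nat (1 :: real poly) (\<lambda>m q. pderiv q * [:d\<^sup>2, 0, -1:]
    - smult (2 * real (N - m)) ([:0, 1:] * q))"
  have r: "r 0 = 1" "r (Suc m) = pderiv (r m) * [:d\<^sup>2, 0, -1:]
    - smult (2 * real (N - m)) ([:0, 1:] * r m)" for m
    by (simp_all add: r_def)
  \<comment> \<open>\<open>p m\<close> is the \<open>m\<close>-th derivative of \<open>max 0 (d\<^sup>2 - y\<^sup>2) ^ N\<close> with the power of
    \<open>max 0 (d\<^sup>2 - y\<^sup>2)\<close> split off; the recursion for \<open>r\<close> is the product rule.\<close>
  define p where "p m y = poly (r m) y * max 0 (d\<^sup>2 - y\<^sup>2) ^ (N - m)" for m y
  show ?thesis
  proof
    fix m y assume m: "m < M"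
    define q where "q = N - Suc m"
    have q: "N - m = Suc q" "q > 0" "N - Suc m = q"
      using m by (auto simp: q_def N_def)
    have max_q: "max 0 v ^ Suc q = v * max 0 v ^ q" for v :: real
      using q(2) by (auto simp: max_def)
    have "((\<lambda>y. max 0 (d\<^sup>2 - y\<^sup>2) ^ Suc q) has_real_derivative
        real (Suc q) * max 0 (d\<^sup>2 - y\<^sup>2) ^ q * (- 2 * y)) (at y)"
      by (rule DERIV_chain2[where g = "\<lambda>y. d\<^sup>2 - y\<^sup>2"])
        (use max_power_has_derivative[of "Suc q" "d\<^sup>2 - y\<^sup>2"] q(2) in \<open>auto intro!: derivative_eq_intros\<close>)
    from DERIV_mult[OF poly_DERIV[of "r m" y] this]
    have "((\<lambda>y. poly (r m) y * max 0 (d\<^sup>2 - y\<^sup>2) ^ Suc q) has_real_derivative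
        poly (pderiv (r m)) y * max 0 (d\<^sup>2 - y\<^sup>2) ^ Suc q +
        real (Suc q) * max 0 (d\<^sup>2 - y\<^sup>2) ^ q * (- 2 * y) * poly (r m) y) (at y)" .
    moreover have "poly (pderiv (r m)) y * max 0 (d\<^sup>2 - y\<^sup>2) ^ Suc q +
        real (Suc q) * max 0 (d\<^sup>2 - y\<^sup>2) ^ q * (- 2 * y) * poly (r m) y = p (Suc m) y"
      unfolding p_def r max_q q by (simp add: algebra_simps power2_eq_square)
    ultimately show "(p m has_real_derivative p (Suc m) y) (at y)"
      unfolding p_def[abs_def] q by simp
  next
    show "continuous_on UNIV (p m)" for m
      unfolding p_def[abs_def] by (intro continuous_intros)
    show "p m y = 0" if "m \<le> M" "\<bar>y\<bar> \<ge> d" for m y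
    proof -
      have "d\<^sup>2 \<le> y\<^sup>2"
        using that(2) assms by (metis abs_le_square_iff abs_of_pos)
      then show ?thesis
        using that(1) by (simp add: p_def N_def)
    qed
    show "p 0 y \<ge> 0" for y
      by (simp add: p_def r)
    show "p 0 0 > 0"
      using assms by (simp add: p_def r)
  qed
qed


text \<open>The zero set is closed and of full measure, hence the whole space.\<close>

lemma continuous_nonneg_integral_0:
  fixes G :: "'a::euclidean_space \<Rightarrow> real"
  assumes "continuous_on UNIV G" "integrable lborel G" "\<And>x. G x \<ge> 0" "integral\<^sup>L lborel G = 0"
  shows "G x = 0"
proof -
  have "AE x in lborel. G x = 0"
    using integral_nonneg_eq_0_iff_AE[OF assms(2)] assms(3,4) by simp
  then have "AE x in lebesgue. x \<in> {x. G x = 0}"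
    by (simp add: AE_completion)
  moreover have "closed {x. G x = 0}"
    using assms(1) by (intro closed_Collect_eq) auto
  ultimately show ?thesis
    using mem_closed_if_AE_lebesgue by blast
qed

text \<open>If \<open>p m\<close> is the \<open>m\<close>-th derivative of \<open>p 0\<close>, this is the jet at \<open>x\<close> of the fields \<open>u = 0\<close>,
  \<open>\<rho> = 1 + \<epsilon> \<Prod>\<^sub>i p 0 (x\<^sub>i - y\<^sub>i)\<close>, \<open>S = s\<close>.\<close>

definition bump_jet :: "(nat \<Rightarrow> real \<Rightarrow> real) \<Rightarrow> real \<Rightarrow> real \<Rightarrow> real^'n \<Rightarrow> real \<Rightarrow> real^'n \<Rightarrow> 'n::finite jet"
  where "bump_jet p t s y \<epsilon> x a = (case a of
       Time \<Rightarrow> t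
     | Space i \<Rightarrow> x $ i
     | Vel i \<alpha> \<Rightarrow> 0
     | Dens \<alpha> \<Rightarrow> (if \<alpha> = {#} then 1 else 0) + \<epsilon> * (\<Prod>i\<in>UNIV. p (count \<alpha> i) (x $ i - y $ i))
     | Entr \<alpha> \<Rightarrow> (if \<alpha> = {#} then s else 0))"

lemma bump_jet_simps:
  "bump_jet p t s y \<epsilon> x Time = t"
  "bump_jet p t s y \<epsilon> x (Vel i \<alpha>) = 0"
  "pos (bump_jet p t s y \<epsilon> x) = x"
  "entr (bump_jet p t s y \<epsilon> x) = s"
  "dens (bump_jet p t s y \<epsilon> x) = 1 + \<epsilon> * (\<Prod>i\<in>UNIV. p 0 (x $ i - y $ i))"
  by (simp_all add: bump_jet_def pos_def entr_def dens_def vec_eq_iff)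

lemma continuous_on_bump_jet:
  assumes "\<And>m. continuous_on UNIV (p m)"
  shows "continuous_on S (bump_jet p t s y \<epsilon>)"
proof (rule continuous_on_coordinatewise_then_product)
  fix a
  have "continuous_on S (\<lambda>x. p m (x $ i - y $ i))" for m i
    by (rule continuous_on_compose2[OF assms[of m]]) (auto intro!: continuous_intros)
  then show "continuous_on S (\<lambda>x. bump_jet p t s y \<epsilon> x a)"
    unfolding bump_jet_def by (cases a) (auto intro!: continuous_intros)
qed

text \<open>Up to order \<open>k\<close> the bump jets are the jets of actual fields: moving the
  base point along an axis changes each coordinate at the rate \<open>shift\<close>. So total
  derivatives turn into ordinary derivatives of composites with \<open>bump_jet\<close>.\<close>

lemma bump_jet_has_derivative:
  assumes p: "\<And>m y. m \<le> k \<Longrightarrow> (p m has_real_derivative p (Suc m) y) (at y)"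
    and a: "coord_order a \<le> k"
  shows "((\<lambda>\<tau>. bump_jet p t s y \<epsilon> (x + \<tau> *\<^sub>R axis j 1) a) has_real_derivative
           shift j (bump_jet p t s y \<epsilon> x) a) (at 0)"
proof (cases a)
  case (Dens \<alpha>)
  have "count \<alpha> j \<le> k"
    using a count_le_size[of \<alpha> j] Dens by simp
  then have "(p (count \<alpha> j) has_real_derivative p (Suc (count \<alpha> j)) (x $ j + 0 - y $ j)) (at (x $ j + 0 - y $ j))"
    by (rule p)
  moreover have "((\<lambda>\<tau>. x $ j + \<tau> - y $ j) has_real_derivative 1) (at 0)"
    by (auto intro!: derivative_eq_intros)
  ultimately have *: "((\<lambda>\<tau>. p (count \<alpha> j) (x $ j + \<tau> - y $ j)) has_real_derivative
      p (Suc (count \<alpha> j)) (x $ j - y $ j)) (at 0)"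
    using DERIV_chain2[where f = "p (count \<alpha> j)" and g = "\<lambda>\<tau>. x $ j + \<tau> - y $ j" and x = 0 and s = UNIV]
    by fastforce
  have split: "(\<Prod>i\<in>UNIV. p (count \<beta> i) (z $ i - y $ i)) =
      p (count \<beta> j) (z $ j - y $ j) * (\<Prod>i\<in>UNIV - {j}. p (count \<beta> i) (z $ i - y $ i))" for \<beta> z
    by (rule prod.remove) auto
  have rest: "(\<Prod>i\<in>UNIV - {j}. p (count \<alpha> i) ((x + \<tau> *\<^sub>R axis j 1) $ i - y $ i)) =
      (\<Prod>i\<in>UNIV - {j}. p (count \<alpha> i) (x $ i - y $ i))" for \<tau>
    by (rule prod.cong) (auto simp: axis_def)
  have rest': "(\<Prod>i\<in>UNIV - {j}. p (count (add_mset j \<alpha>) i) (x $ i - y $ i)) =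
      (\<Prod>i\<in>UNIV - {j}. p (count \<alpha> i) (x $ i - y $ i))"
    by (rule prod.cong) auto
  have "((\<lambda>\<tau>. \<Prod>i\<in>UNIV. p (count \<alpha> i) ((x + \<tau> *\<^sub>R axis j 1) $ i - y $ i)) has_real_derivative
      (\<Prod>i\<in>UNIV. p (count (add_mset j \<alpha>) i) (x $ i - y $ i))) (at 0)"
    unfolding split rest rest' using DERIV_cmult_right[OF *] by (simp add: axis_def)
  from DERIV_add[OF DERIV_const[of "if \<alpha> = {#} then 1 else 0"] DERIV_cmult[OF this, of \<epsilon>]]
  show ?thesis
    by (simp add: Dens bump_jet_def)
qed (auto simp: bump_jet_def axis_def intro!: derivative_eq_intros)

text \<open>Grouped so that the coefficient of each component is the logarithmic derivative of the
  volume factor.\<close>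

lemma Div_eq_contraction:
  "Div h X z = (\<Sum>i\<in>UNIV. total_deriv i (\<lambda>w. X w $ i) z +
     (\<Sum>k\<in>UNIV. christoffel h (pos z) k k i) * X z $ i)"
proof -
  have "(\<Sum>i\<in>UNIV. \<Sum>j\<in>UNIV. christoffel h (pos z) i i j * X z $ j) =
      (\<Sum>i\<in>UNIV. \<Sum>k\<in>UNIV. christoffel h (pos z) k k i * X z $ i)"
    by (rule sum.swap)
  then show ?thesis
    by (simp add: Div_def covd_def sum.distrib sum_distrib_right)
qed

text \<open>Evaluate \<open>\<Phi>\<close> on the two fields \<open>\<rho> = 1\<close> and \<open>\<rho> = 1 + bump\<close>. The difference of the divergences
  integrates to zero, since all relevant derivatives of the bump vanish on the boundary of its
  support, but its integral is also \<open>\<beta>\<close> times the positive integral of the bump.\<close>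

lemma divergence_not_affine_in_density:
  fixes c :: "('m, 'n::finite) chart"
  assumes h: "metric_on (chart_image c) h" and opn: "open (chart_image c)"
    and \<Phi>: "\<And>i. smooth_jet (jet_dom c) (\<lambda>z. \<Phi> z $ i)"
    and dep: "depends_only_on (jet_dom c) {a. coord_order a \<le> k} \<Phi>"
    and y: "open U" "y \<in> U" "U \<subseteq> chart_image c"
    and affine: "\<And>z z'. \<lbrakk>z \<in> jet_dom c; z' \<in> jet_dom c; pos z \<in> U; pos z' = pos z;
        z Time = t; z' Time = t; entr z = s; entr z' = s;
        \<And>i \<alpha>. z (Vel i \<alpha>) = 0; \<And>i \<alpha>. z' (Vel i \<alpha>) = 0\<rbrakk>
      \<Longrightarrow> Div h \<Phi> z' - Div h \<Phi> z = \<beta> * (dens z' - dens z)"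
  shows "\<beta> = 0"
proof (rule ccontr)
  assume \<beta>: "\<beta> \<noteq> 0"
  obtain r where r: "r > 0" "ball y r \<subseteq> U"
    using y open_contains_ball by blast
  \<comment> \<open>The cube of half side \<open>d\<close> around \<open>y\<close> has l1-radius
    \<open>CARD('n) * d < r\<close>, so it lies in the ball.\<close>
  define d where "d = r / (real CARD('n) + 1)"
  have d: "d > 0"
    using r(1) by (simp add: d_def)
  \<comment> \<open>The divergence of a field of order \<open>k\<close> reads jets of order
    \<open>k + 1\<close>, through \<open>shift\<close>; the bump is flat to order
    \<open>k + 2\<close> at the boundary of its support.\<close>
  obtain p :: "nat \<Rightarrow> real \<Rightarrow> real" where
    p_deriv: "\<And>m y. m < k + 2 \<Longrightarrow> (p m has_real_derivative p (Suc m) y) (at y)"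
    and p_cont: "\<And>m. continuous_on UNIV (p m)"
    and p_supp: "\<And>m y. m \<le> k + 2 \<Longrightarrow> \<bar>y\<bar> \<ge> d \<Longrightarrow> p m y = 0"
    and p_nonneg: "\<And>y. p 0 y \<ge> 0" and p_pos: "p 0 0 > 0"
    using flat_bump[OF d, of "k + 2"] by metis
  define K where "K = cbox (y - (\<chi> i. d)) (y + (\<chi> i. d))"
  have K_iff: "x \<in> K \<longleftrightarrow> (\<forall>i. \<bar>x $ i - y $ i\<bar> \<le> d)" for x
    unfolding K_def mem_box_cart by (auto simp: abs_le_iff algebra_simps)
  have K_U: "K \<subseteq> U"
  proof
    fix x assume "x \<in> K"
    then have "\<bar>(x - y) $ i\<bar> \<le> d" for i
      by (simp add: K_iff)
    then have "norm (x - y) \<le> real CARD('n) * d"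
      using norm_le_l1_cart[of "x - y"] sum_bounded_above[of UNIV "\<lambda>i. \<bar>(x - y) $ i\<bar>" d]
      by (meson order_trans)
    also have "\<dots> < r"
      using r(1) by (simp add: d_def field_simps)
    finally have "x \<in> ball y r"
      by (simp add: dist_norm norm_minus_commute)
    with r(2) show "x \<in> U"
      by blast
  qed
  have K: "closed K" "bounded K"
    by (simp_all add: K_def closed_cbox bounded_cbox)
  define J where "J = bump_jet p t s y"
  define \<phi> where "\<phi> x = (\<Prod>i\<in>UNIV. p 0 (x $ i - y $ i))" for x :: "real^'n"
  have \<phi>_nonneg: "\<phi> x \<ge> 0" for x
    by (simp add: \<phi>_def prod_nonneg p_nonneg)
  have \<phi>_supp: "(\<Prod>i\<in>UNIV. p (count \<alpha> i) (x $ i - y $ i)) = 0" if "x \<notin> K" "size \<alpha> \<le> k + 2" for x \<alpha>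
  proof -
    obtain i where "\<bar>x $ i - y $ i\<bar> \<ge> d"
      using \<open>x \<notin> K\<close> unfolding K_iff by (meson linear)
    then have "p (count \<alpha> i) (x $ i - y $ i) = 0"
      using that(2) count_le_size[of \<alpha> i] by (intro p_supp) auto
    then show ?thesis
      by (intro prod_zero bexI[of _ i]) auto
  qed
  \<comment> \<open>The values 0 and 1 of \<open>\<epsilon>\<close> give the unperturbed and the
    perturbed field. A nonnegative bump keeps the density positive.\<close>
  have J_dom: "J \<epsilon> x \<in> jet_dom c" if "x \<in> U" "\<epsilon> \<ge> 0" for \<epsilon> x
    using that y(3) \<phi>_nonneg[of x] by (auto simp: jet_dom_def J_def bump_jet_simps \<phi>_def add_pos_nonneg)
  have J_eq: "J 1 x a = J 0 x a" if "x \<notin> K" "coord_order a \<le> k + 2" for x a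
    using that \<phi>_supp by (cases a) (auto simp: J_def bump_jet_def)
  have J_cont: "continuous_on S (J \<epsilon>)" for S \<epsilon>
    unfolding J_def by (rule continuous_on_bump_jet[OF p_cont])
  define N where "N = {a :: 'n coord. coord_order a \<le> k}"
  have N: "finite N"
    unfolding N_def by (rule coord_order_finite)
  have dom_open: "open (jet_dom c)"
    by (rule open_jet_dom[OF opn])
  have dep_i: "depends_only_on (jet_dom c) N (\<lambda>z. \<Phi> z $ i)" for i
    using dep unfolding N_def depends_only_on_def by metis
  define TD where "TD i z = total_deriv i (\<lambda>w. \<Phi> w $ i) z" for i z
  have TD: "TD i z = (\<Sum>a\<in>N. shift i z a * pd a (\<lambda>w. \<Phi> w $ i) z)" if "z \<in> jet_dom c" for i z
    unfolding TD_def by (rule total_deriv_eq_sum[OF N]) (rule pd_outside[OF dom_open that dep_i])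
  define w where "w = volume_factor h"
  define \<Gamma> where "\<Gamma> i x = (\<Sum>l\<in>UNIV. christoffel h x l l i)" for i x
  \<comment> \<open>\<open>Y i\<close> is the weighted difference of the flux components on the two
    fields, continued by 0 outside \<open>U\<close>; \<open>D i\<close> is what the product rule
    gives for its derivative along axis \<open>i\<close>.\<close>
  define Y where "Y i x = (if x \<in> U then w x * (\<Phi> (J 1 x) $ i - \<Phi> (J 0 x) $ i) else 0)" for i x
  define D where "D i x = (if x \<in> U then w x * \<Gamma> i x * (\<Phi> (J 1 x) $ i - \<Phi> (J 0 x) $ i) +
      w x * (TD i (J 1 x) - TD i (J 0 x)) else 0)" for i x
  have outside: "\<Phi> (J 1 x) $ i = \<Phi> (J 0 x) $ i" "TD i (J 1 x) = TD i (J 0 x)" if "x \<in> U" "x \<notin> K" for i x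
  proof -
    have N_eq: "\<forall>a\<in>N. J 1 x a = J 0 x a"
      using J_eq[OF that(2)] by (simp add: N_def)
    then show "\<Phi> (J 1 x) $ i = \<Phi> (J 0 x) $ i"
      using dep_i[of i] J_dom[OF that(1)] unfolding depends_only_on_def by auto
    have "pd a (\<lambda>w. \<Phi> w $ i) (J 1 x) = pd a (\<lambda>w. \<Phi> w $ i) (J 0 x)" for a
      using pd_depends_only_on[OF dom_open dep_i[of i], of a] J_dom[OF that(1)] N_eq
      unfolding depends_only_on_def by auto
    moreover have "shift i (J 1 x) a = shift i (J 0 x) a" if "a \<in> N" for a
      using that J_eq[OF \<open>x \<notin> K\<close>] by (cases a) (auto simp: N_def)
    ultimately show "TD i (J 1 x) = TD i (J 0 x)"
      using TD J_dom[OF that(1)] by (simp cong: sum.cong)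
  qed
  have Y_out: "Y i x = 0" and D_out: "D i x = 0" if "x \<notin> K" for i x
    using outside[OF _ that] by (auto simp: Y_def D_def)
  \<comment> \<open>\<open>U\<close> and the complement of the closed cube are open and cover the
    space, so continuity can be checked on each.\<close>
  have cover: "U \<union> - K = UNIV"
    using K_U by blast
  have glue: "continuous_on UNIV f" if "continuous_on U f" "\<And>x. x \<notin> K \<Longrightarrow> f x = 0" for f :: "real^'n \<Rightarrow> real"
  proof -
    have "continuous_on (- K) f"
      by (rule continuous_on_eq[OF continuous_on_const[of _ 0]]) (simp add: that(2))
    then show ?thesis
      using continuous_on_open_Un[OF y(1) open_Compl[OF K(1)] that(1)] unfolding cover by blast
  qed
  have cont_J: "continuous_on U (\<lambda>x. F (J \<epsilon> x))" if "smooth_jet (jet_dom c) F" "\<epsilon> \<ge> 0" for F \<epsilon>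
    by (rule continuous_on_compose2[OF smooth_jet_continuous[OF that(1)] J_cont])
      (use J_dom that(2) in auto)
  have w_cont: "continuous_on U w"
    using continuous_on_volume_factor[OF h] y(3) continuous_on_subset unfolding w_def by blast
  have \<Gamma>_cont: "continuous_on U (\<Gamma> i)" for i
    unfolding \<Gamma>_def[abs_def]
    by (intro continuous_on_sum continuous_on_subset[OF continuous_on_christoffel[OF h] y(3)])
  have shift_cont: "continuous_on S (\<lambda>x. shift i (J \<epsilon> x) a)" for S i \<epsilon> a
    using continuous_on_product_then_coordinatewise[OF J_cont]
    by (cases a) auto
  have TD_cont: "continuous_on U (\<lambda>x. TD i (J \<epsilon> x))" if "\<epsilon> \<ge> 0" for i \<epsilon>
  proof -
    have "continuous_on U (\<lambda>x. \<Sum>a\<in>N. shift i (J \<epsilon> x) a * pd a (\<lambda>w. \<Phi> w $ i) (J \<epsilon> x))"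
      by (intro continuous_intros shift_cont cont_J smooth_jet_pd \<Phi> that)
    then show ?thesis
      using TD J_dom that by (simp cong: continuous_on_cong)
  qed
  have Y_cont: "continuous_on UNIV (Y i)" for i
  proof (rule glue[OF _ Y_out])
    have "continuous_on U (\<lambda>x. w x * (\<Phi> (J 1 x) $ i - \<Phi> (J 0 x) $ i))"
      by (intro continuous_intros w_cont cont_J[of "\<lambda>z. \<Phi> z $ i"] \<Phi>) auto
    then show "continuous_on U (Y i)"
      by (simp add: Y_def[abs_def] cong: continuous_on_cong)
  qed
  have D_cont: "continuous_on UNIV (D i)" for i
  proof (rule glue[OF _ D_out])
    have "continuous_on U (\<lambda>x. w x * \<Gamma> i x * (\<Phi> (J 1 x) $ i - \<Phi> (J 0 x) $ i) +
      w x * (TD i (J 1 x) - TD i (J 0 x)))"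
      by (intro continuous_intros w_cont \<Gamma>_cont TD_cont cont_J[of "\<lambda>z. \<Phi> z $ i"] \<Phi>) auto
    then show "continuous_on U (D i)"
      by (simp add: D_def[abs_def] cong: continuous_on_cong)
  qed
  have line: "\<forall>\<^sub>F \<tau> in nhds 0. x + \<tau> *\<^sub>R axis i 1 \<in> V" if "open V" "x \<in> V" for x :: "real^'n" and i V
  proof -
    have "((\<lambda>\<tau>. x + \<tau> *\<^sub>R axis i 1) \<longlongrightarrow> x + 0 *\<^sub>R axis i 1) (nhds 0)"
      by (intro tendsto_intros filterlim_ident)
    then show ?thesis
      using that topological_tendstoD by fastforce
  qed
  have Y_deriv: "((\<lambda>\<tau>. Y i (x + \<tau> *\<^sub>R axis i 1)) has_real_derivative D i x) (at 0)" for i x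
  proof (cases "x \<in> U")
    case True
    \<comment> \<open>Along the field the jet coordinates change by \<open>shift\<close>, so the
      ordinary derivative of the composite is the total derivative of the component.\<close>
    have \<Phi>_deriv: "((\<lambda>\<tau>. \<Phi> (J \<epsilon> (x + \<tau> *\<^sub>R axis i 1)) $ i) has_real_derivative TD i (J \<epsilon> x)) (at 0)"
      if \<epsilon>: "\<epsilon> \<ge> 0" for \<epsilon>
    proof -
      have "\<forall>\<^sub>F \<tau> in nhds 0. J \<epsilon> (x + \<tau> *\<^sub>R axis i 1) \<in> jet_dom c"
        using line[OF y(1) True, of i] by eventually_elim (rule J_dom[OF _ \<epsilon>])
      moreover have "((\<lambda>\<tau>. J \<epsilon> (x + \<tau> *\<^sub>R axis i 1) a) has_real_derivative shift i (J \<epsilon> x) a) (at 0)"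
        if "a \<in> N" for a
        unfolding J_def using that p_deriv by (intro bump_jet_has_derivative[of k]) (auto simp: N_def)
      ultimately have "((\<lambda>\<tau>. \<Phi> (J \<epsilon> (x + \<tau> *\<^sub>R axis i 1)) $ i) has_real_derivative
          (\<Sum>a\<in>N. shift i (J \<epsilon> x) a * pd a (\<lambda>w. \<Phi> w $ i) (J \<epsilon> (x + 0 *\<^sub>R axis i 1)))) (at 0)"
        using J_dom[OF True \<epsilon>]
        by (intro chain_rule_jet[where F = "\<lambda>z. \<Phi> z $ i" and \<gamma> = "\<lambda>\<tau>. J \<epsilon> (x + \<tau> *\<^sub>R axis i 1)",
              OF dom_open _ _ \<Phi> N dep_i]) auto
      then show ?thesis
        using TD[OF J_dom[OF True \<epsilon>]] by simp
    qed
    have "((\<lambda>\<tau>. w (x + \<tau> *\<^sub>R axis i 1) *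
          (\<Phi> (J 1 (x + \<tau> *\<^sub>R axis i 1)) $ i - \<Phi> (J 0 (x + \<tau> *\<^sub>R axis i 1)) $ i)) has_real_derivative
        w x * \<Gamma> i x * (\<Phi> (J 1 (x + 0 *\<^sub>R axis i 1)) $ i - \<Phi> (J 0 (x + 0 *\<^sub>R axis i 1)) $ i) +
        (TD i (J 1 x) - TD i (J 0 x)) * w (x + 0 *\<^sub>R axis i 1)) (at 0)"
      unfolding w_def \<Gamma>_def
      by (intro DERIV_mult DERIV_diff \<Phi>_deriv volume_factor_has_derivative[OF h opn]) (use True y(3) in auto)
    moreover have "\<forall>\<^sub>F \<tau> in nhds 0. w (x + \<tau> *\<^sub>R axis i 1) *
          (\<Phi> (J 1 (x + \<tau> *\<^sub>R axis i 1)) $ i - \<Phi> (J 0 (x + \<tau> *\<^sub>R axis i 1)) $ i) =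
        Y i (x + \<tau> *\<^sub>R axis i 1)"
      using line[OF y(1) True, of i] by eventually_elim (simp add: Y_def)
    ultimately show ?thesis
      using True by (subst (asm) DERIV_cong_ev[OF refl _ refl]) (auto simp: D_def mult.commute)
  next
    case False
    then have "x \<in> - K"
      using K_U by blast
    then have "\<forall>\<^sub>F \<tau> in nhds 0. Y i (x + \<tau> *\<^sub>R axis i 1) = 0"
      using line[of "- K" x i] K(1) by (auto simp: open_Compl Y_out elim: eventually_mono)
    then show ?thesis
      using False by (subst DERIV_cong_ev[OF refl _ refl, where g = "\<lambda>_. 0"]) (auto simp: D_def)
  qed
  have D_int: "integrable lborel (D i)" for i
    by (rule integrable_continuous_bounded_support[OF D_cont K(2) D_out])
  have D_integral: "integral\<^sup>L lborel (D i) = 0" for i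
    by (rule integral_directional_derivative_eq_0[OF Y_deriv Y_cont D_cont K(2) Y_out D_out])
  \<comment> \<open>The sum of the \<open>D i\<close> is the weighted difference of the divergences,
    hence \<open>\<beta>\<close> times \<open>G\<close>. But \<open>G\<close> is the weighted bump,
    nonnegative and positive at \<open>y\<close>, yet of integral 0.\<close>
  define G where "G x = (if x \<in> U then w x * \<phi> x else 0)" for x
  have "(\<Sum>i\<in>UNIV. D i x) = \<beta> * G x" for x
  proof (cases "x \<in> U")
    case True
    have "Div h \<Phi> (J \<epsilon> x) = (\<Sum>i\<in>UNIV. TD i (J \<epsilon> x) + \<Gamma> i x * \<Phi> (J \<epsilon> x) $ i)" for \<epsilon>
      by (simp add: Div_eq_contraction TD_def \<Gamma>_def J_def bump_jet_simps)
    then have "(\<Sum>i\<in>UNIV. D i x) = w x * (Div h \<Phi> (J 1 x) - Div h \<Phi> (J 0 x))"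
      using True by (simp add: D_def sum_distrib_left sum_subtractf[symmetric] algebra_simps)
    also have "Div h \<Phi> (J 1 x) - Div h \<Phi> (J 0 x) = \<beta> * (dens (J 1 x) - dens (J 0 x))"
      by (rule affine) (use J_dom[OF True] True in \<open>auto simp: J_def bump_jet_simps\<close>)
    also have "dens (J 1 x) - dens (J 0 x) = \<phi> x"
      by (simp add: J_def bump_jet_simps \<phi>_def)
    finally show ?thesis
      using True by (simp add: G_def)
  qed (simp add: D_def G_def)
  then have G_eq: "G = (\<lambda>x. (\<Sum>i\<in>UNIV. D i x) / \<beta>)"
    using \<beta> by (simp add: fun_eq_iff)
  have "continuous_on UNIV G"
    unfolding G_eq using \<beta> by (intro continuous_intros D_cont) simp
  moreover have "integrable lborel G" "integral\<^sup>L lborel G = 0"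
    unfolding G_eq using D_int D_integral by simp_all
  moreover have "G x \<ge> 0" for x
    using volume_factor_pos[OF h, of x] y(3) \<phi>_nonneg[of x] by (auto simp: G_def w_def less_imp_le)
  ultimately have "G y = 0"
    using continuous_nonneg_integral_0 by blast
  moreover have "G y > 0"
    using volume_factor_pos[OF h, of y] y p_pos by (auto simp: G_def w_def \<phi>_def prod_pos)
  ultimately show False
    by simp
qed


section \<open>The densities \<open>\<rho> F(S)\<close> are Casimirs\<close>

definition jet_differentiable :: "('n jet \<Rightarrow> real) \<Rightarrow> 'n jet \<Rightarrow> bool" where
  "jet_differentiable F z \<longleftrightarrow>
     (\<forall>a. (\<lambda>s. F (z(a := s))) differentiable (at (z a))) \<and> finite {a. pd a F z \<noteq> 0}"

lemma jet_differentiable_pd: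
  "jet_differentiable F z \<Longrightarrow> ((\<lambda>s. F (z(a := s))) has_real_derivative pd a F z) (at (z a))"
  unfolding jet_differentiable_def pd_def by (simp add: DERIV_deriv_iff_real_differentiable)

lemma jet_differentiableI:
  assumes "\<And>a. ((\<lambda>s. F (z(a := s))) has_real_derivative D a) (at (z a))" "finite {a. D a \<noteq> 0}"
  shows "jet_differentiable F z" "pd a F z = D a"
proof -
  show pd: "pd a F z = D a" for a
    using assms(1) by (rule pd_eqI)
  then show "jet_differentiable F z"
    using assms unfolding jet_differentiable_def by (auto simp: real_differentiable_def)
qed

lemma smooth_jet_differentiable:
  assumes "smooth_jet U F" "open U" "depends_only_on U C F" "finite C" "z \<in> U"
  shows "jet_differentiable F z"
proof (rule jet_differentiableI(1))
  show "((\<lambda>s. F (z(a := s))) has_real_derivative pd a F z) (at (z a))" for a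
    using assms(1,5) by (rule smooth_jet_has_derivative)
  have "{a. pd a F z \<noteq> 0} \<subseteq> C"
    using pd_outside[OF assms(2,5,3)] by blast
  then show "finite {a. pd a F z \<noteq> 0}"
    using assms(4) finite_subset by blast
qed

text \<open>A sum over an infinite set is 0 by convention, so \<open>total_deriv\<close> has its
  meaning only where finitely many partial derivatives are nonzero; hence the finiteness clause in
  \<open>jet_differentiable\<close>. All three sums are taken over the union of the two
  supports.\<close>

lemma
  assumes "jet_differentiable F z" "jet_differentiable G z"
  shows jet_differentiable_mult: "jet_differentiable (\<lambda>w. F w * G w) z"
    and total_deriv_mult: "total_deriv j (\<lambda>w. F w * G w) z =
      total_deriv j F z * G z + F z * total_deriv j G z"
proof -
  define N where "N = {a. pd a F z \<noteq> 0} \<union> {a. pd a G z \<noteq> 0}"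
  have N: "finite N"
    using assms by (simp add: N_def jet_differentiable_def)
  have D: "((\<lambda>s. F (z(a := s)) * G (z(a := s))) has_real_derivative
      pd a F z * G z + pd a G z * F z) (at (z a))" for a
    using DERIV_mult[OF assms[THEN jet_differentiable_pd, of a]] by simp
  then have pd: "pd a (\<lambda>w. F w * G w) z = pd a F z * G z + pd a G z * F z" for a
    by (rule pd_eqI)
  have "finite {a. pd a F z * G z + pd a G z * F z \<noteq> 0}"
    using N by (rule rev_finite_subset) (auto simp: N_def)
  with D show "jet_differentiable (\<lambda>w. F w * G w) z"
    by (rule jet_differentiableI(1))
  have "total_deriv j F z = (\<Sum>a\<in>N. shift j z a * pd a F z)"
    "total_deriv j G z = (\<Sum>a\<in>N. shift j z a * pd a G z)"
    "total_deriv j (\<lambda>w. F w * G w) z = (\<Sum>a\<in>N. shift j z a * pd a (\<lambda>w. F w * G w) z)"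
    by (rule total_deriv_eq_sum[OF N]; simp add: N_def pd)+
  then show "total_deriv j (\<lambda>w. F w * G w) z = total_deriv j F z * G z + F z * total_deriv j G z"
    by (simp add: pd sum_distrib_left sum_distrib_right sum.distrib[symmetric] algebra_simps)
qed

lemma total_deriv_add:
  assumes "jet_differentiable F z" "jet_differentiable G z"
  shows "total_deriv j (\<lambda>w. F w + G w) z = total_deriv j F z + total_deriv j G z"
proof -
  define N where "N = {a. pd a F z \<noteq> 0} \<union> {a. pd a G z \<noteq> 0}"
  have N: "finite N"
    using assms by (simp add: N_def jet_differentiable_def)
  have pd: "pd a (\<lambda>w. F w + G w) z = pd a F z + pd a G z" for a
    using DERIV_add[OF assms[THEN jet_differentiable_pd, of a]] by (rule pd_eqI)
  have "total_deriv j F z = (\<Sum>a\<in>N. shift j z a * pd a F z)"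
    "total_deriv j G z = (\<Sum>a\<in>N. shift j z a * pd a G z)"
    "total_deriv j (\<lambda>w. F w + G w) z = (\<Sum>a\<in>N. shift j z a * pd a (\<lambda>w. F w + G w) z)"
    by (rule total_deriv_eq_sum[OF N]; simp add: N_def pd)+
  then show ?thesis
    by (simp add: pd sum.distrib[symmetric] algebra_simps)
qed

lemma
  shows jet_differentiable_coord: "jet_differentiable (\<lambda>w. w b) z"
    and total_deriv_coord: "total_deriv j (\<lambda>w. w b) z = shift j z b"
proof -
  have "((\<lambda>s. (z(a := s)) b) has_real_derivative (if a = b then 1 else 0)) (at (z a))" for a
    by auto
  from jet_differentiableI[OF this]
  have diff: "jet_differentiable (\<lambda>w. w b) z"
    and pd: "pd a (\<lambda>w. w b) z = (if a = b then 1 else 0)" for a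
    by simp_all
  show "jet_differentiable (\<lambda>w. w b) z"
    by (rule diff)
  show "total_deriv j (\<lambda>w. w b) z = shift j z b"
    by (subst total_deriv_eq_sum[of "{b}"]) (auto simp: pd)
qed

lemma
  assumes "(f has_real_derivative f') (at (F z))" "jet_differentiable F z"
  shows jet_differentiable_compose: "jet_differentiable (\<lambda>w. f (F w)) z"
    and total_deriv_compose: "total_deriv j (\<lambda>w. f (F w)) z = f' * total_deriv j F z"
proof -
  define N where "N = {a. pd a F z \<noteq> 0}"
  have N: "finite N"
    using assms by (simp add: N_def jet_differentiable_def)
  have f: "(f has_real_derivative f') (at (F (z(a := z a))))" for a
    using assms(1) by simp
  have D: "((\<lambda>s. f (F (z(a := s)))) has_real_derivative f' * pd a F z) (at (z a))" for a
    using DERIV_chain2[where f = f and g = "\<lambda>s. F (z(a := s))", OF f jet_differentiable_pd[OF assms(2)]] .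
  then have pd: "pd a (\<lambda>w. f (F w)) z = f' * pd a F z" for a
    by (rule pd_eqI)
  have "finite {a. f' * pd a F z \<noteq> 0}"
    using N by (rule rev_finite_subset) (auto simp: N_def)
  with D show "jet_differentiable (\<lambda>w. f (F w)) z"
    by (rule jet_differentiableI(1))
  have "total_deriv j F z = (\<Sum>a\<in>N. shift j z a * pd a F z)"
    "total_deriv j (\<lambda>w. f (F w)) z = (\<Sum>a\<in>N. shift j z a * pd a (\<lambda>w. f (F w)) z)"
    by (rule total_deriv_eq_sum[OF N]; simp add: N_def pd)+
  then show "total_deriv j (\<lambda>w. f (F w)) z = f' * total_deriv j F z"
    by (simp add: pd sum_distrib_left mult_ac)
qed

lemma
  shows jet_differentiable_dens: "jet_differentiable dens z"
    and jet_differentiable_entr: "jet_differentiable entr z"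
    and jet_differentiable_vel: "jet_differentiable (\<lambda>w. vel w $ i) z"
    and total_deriv_entr: "total_deriv j entr z = z (Entr {#j#})"
  unfolding dens_def[abs_def] entr_def[abs_def] vel_def
  by (simp_all add: jet_differentiable_coord total_deriv_coord)

section \<open>Smooth functions of one variable, and of density and entropy\<close>

definition smooth_real :: "(real \<Rightarrow> real) \<Rightarrow> bool" where
  "smooth_real f \<longleftrightarrow> (\<forall>k x. (deriv ^^ k) f differentiable (at x))"

lemma smooth_real_has_derivative: "smooth_real f \<Longrightarrow> (f has_real_derivative deriv f x) (at x)"
  unfolding smooth_real_def
  using DERIV_deriv_iff_real_differentiable[of f x] spec[of _ 0] by (metis funpow_0)

lemma smooth_real_deriv: "smooth_real f \<Longrightarrow> smooth_real (deriv f)"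
  unfolding smooth_real_def
proof (intro allI)
  fix k x assume "\<forall>k x. (deriv ^^ k) f differentiable (at x)"
  then have "(deriv ^^ Suc k) f differentiable (at x)"
    by blast
  then show "(deriv ^^ k) (deriv f) differentiable (at x)"
    by (simp only: funpow_Suc_right comp_apply)
qed

text \<open>A class of differentiable functions closed under \<open>deriv\<close> contains all
  iterated derivatives of its members, so these never have to be computed.\<close>

lemma smooth_real_coinduct:
  assumes "X f" "\<And>f. X f \<Longrightarrow> (\<forall>x. f differentiable (at x)) \<and> X (deriv f)"
  shows "smooth_real f"
proof -
  have "X ((deriv ^^ k) f)" for k
    using assms by (induction k) auto
  then show ?thesis
    unfolding smooth_real_def using assms(2) by blast
qed

lemma smooth_real_affine:
  assumes "smooth_real f"
  shows "smooth_real (\<lambda>x. a + b * f x)"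
proof (rule smooth_real_coinduct[where X = "\<lambda>h. \<exists>a b f. h = (\<lambda>x. a + b * f x) \<and> smooth_real f"])
  fix h assume "\<exists>a b f. h = (\<lambda>x. a + b * f x) \<and> smooth_real f"
  then obtain a b f where h: "h = (\<lambda>x. a + b * f x)" and f: "smooth_real f"
    by blast
  have d: "(h has_real_derivative 0 + b * deriv f x) (at x)" for x
    unfolding h by (intro DERIV_add DERIV_const DERIV_cmult smooth_real_has_derivative f)
  then have "deriv h = (\<lambda>x. 0 + b * deriv f x)"
    using DERIV_imp_deriv by blast
  then show "(\<forall>x. h differentiable (at x)) \<and> (\<exists>a b f. deriv h = (\<lambda>x. a + b * f x) \<and> smooth_real f)"
    using d smooth_real_deriv[OF f] real_differentiable_def by blast
qed (use assms in blast)

lemma smooth_real_const: "smooth_real (\<lambda>x. k)"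
  by (rule smooth_real_coinduct[where X = "\<lambda>h. \<exists>k. h = (\<lambda>x. k)"]) auto

lemma smooth_real_id: "smooth_real (\<lambda>x. x)"
proof (rule smooth_real_coinduct[where X = "\<lambda>h. h = (\<lambda>x. x) \<or> (\<exists>k. h = (\<lambda>x. k))"])
  fix h :: "real \<Rightarrow> real" assume "h = (\<lambda>x. x) \<or> (\<exists>k. h = (\<lambda>x. k))"
  then show "(\<forall>x. h differentiable (at x)) \<and> (deriv h = (\<lambda>x. x) \<or> (\<exists>k. deriv h = (\<lambda>x. k)))"
    by auto
qed simp

lemma pd_density:
  assumes "smooth_real F" "smooth_real G"
  shows "((\<lambda>s. dens (z(a := s)) * F (entr (z(a := s))) + G (entr (z(a := s)))) has_real_derivative
     (if a = Dens {#} then F (entr z) else if a = Entr {#}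
      then dens z * deriv F (entr z) + deriv G (entr z) else 0)) (at (z a))"
proof -
  consider "a = Dens {#}" | "a = Entr {#}" | "a \<noteq> Dens {#}" "a \<noteq> Entr {#}"
    by blast
  then show ?thesis
  proof cases
    case 1
    then show ?thesis
      by (auto simp: dens_def entr_def intro!: derivative_eq_intros)
  next
    case 2
    have "((\<lambda>s. z (Dens {#}) * F s + G s) has_real_derivative
        z (Dens {#}) * deriv F (z a) + deriv G (z a)) (at (z a))"
      by (intro DERIV_add DERIV_cmult smooth_real_has_derivative assms)
    then show ?thesis
      using 2 by (simp add: dens_def entr_def)
  qed (auto simp: dens_def entr_def)
qed

text \<open>The summand \<open>G (entr z)\<close> is there for the induction: it makes the family
  closed under every \<open>pd a\<close>, since differentiating in the density removes the factor
  \<open>dens z\<close>.\<close>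

lemma smooth_jet_density:
  assumes "smooth_real F" "smooth_real G"
  shows "smooth_jet U (\<lambda>z :: 'n jet. dens z * F (entr z) + G (entr z))"
  unfolding smooth_jet_def
proof
  fix k
  show "Ck_jet k U (\<lambda>z :: 'n jet. dens z * F (entr z) + G (entr z))"
    using assms
  proof (induction k arbitrary: F G)
    case (0 F G)
    have coord: "continuous_on U (\<lambda>z :: 'n jet. z a)" for a
      by (rule continuous_on_subset[OF continuous_on_product_coordinates]) simp
    have comp: "continuous_on U (\<lambda>z :: 'n jet. f (z (Entr {#})))" if "smooth_real f" for f
    proof (rule continuous_on_compose2[OF _ coord])
      show "continuous_on UNIV f"
        by (intro continuous_at_imp_continuous_on ballI)
          (rule DERIV_isCont[OF smooth_real_has_derivative[OF that]])
    qed simp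
    show ?case
      unfolding Ck_jet.simps dens_def entr_def by (intro continuous_intros coord comp 0)
  next
    case (Suc k F G)
    let ?T = "\<lambda>z :: 'n jet. dens z * F (entr z) + G (entr z)"
    have "Ck_jet k U ?T"
      by (rule Suc.IH[OF Suc.prems])
    then have "continuous_on U ?T"
      by (cases k) auto
    moreover have "Ck_jet k U (pd a ?T)" for a
    proof -
      have pd: "pd a ?T z = (if a = Dens {#} then F (entr z) else if a = Entr {#}
          then dens z * deriv F (entr z) + deriv G (entr z) else 0)" for z
        by (rule pd_eqI[OF pd_density[OF Suc.prems]])
      consider "a = Dens {#}" | "a = Entr {#}" | "a \<noteq> Dens {#}" "a \<noteq> Entr {#}"
        by blast
      then show ?thesis
      proof cases
        case 1
        have "pd a ?T = (\<lambda>z. dens z * 0 + F (entr z))"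
          using pd 1 by auto
        then show ?thesis
          using Suc.IH[OF smooth_real_const Suc.prems(1), of 0] by simp
      next
        case 2
        have "pd a ?T = (\<lambda>z. dens z * deriv F (entr z) + deriv G (entr z))"
          using pd 2 by auto
        then show ?thesis
          using Suc.IH[OF Suc.prems[THEN smooth_real_deriv]] by simp
      next
        case 3
        have "pd a ?T = (\<lambda>z. dens z * 0 + 0)"
          using pd 3 by auto
        then show ?thesis
          using Suc.IH[OF smooth_real_const smooth_real_const, of 0 0] by simp
      qed
    qed
    moreover have "(\<lambda>s. ?T (z(a := s))) differentiable (at (z a))" for z a
      using pd_density[OF Suc.prems, of z a] unfolding real_differentiable_def by blast
    ultimately show ?case
      by simp
  qed
qed

lemma mderiv_empty [simp]: "mderiv {#} f = f"
  by (simp add: mderiv_def)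

lemma riemannian_metric_on: "riemannian_metric A g \<Longrightarrow> c \<in> A \<Longrightarrow> metric_on (chart_image c) (g c)"
  unfolding riemannian_metric_def metric_on_def by blast

lemma smooth_atlas_open: "smooth_atlas A \<Longrightarrow> c \<in> A \<Longrightarrow> open (chart_image c)"
  unfolding smooth_atlas_def by blast

lemma smooth_jet_const: "smooth_jet U (\<lambda>z :: 'n jet. k)"
  using smooth_jet_density[OF smooth_real_const[of 0] smooth_real_const[of k], of U] by simp

lemma hamiltonian_op_zero:
  fixes z :: "'n::finite jet"
  shows "hamiltonian_op h (\<lambda>w. 0) b s z = ((s z / dens z) *\<^sub>R Grad h entr z - Grad h b z, 0, 0)"
proof -
  have curl: "(\<chi> i. (1 / dens z) * (\<Sum>j\<in>UNIV. curl_vel h i j z * (0 :: real^'n) $ j)) = 0"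
    by (simp add: vec_eq_iff)
  have "sharp h (\<lambda>w. 0) = (\<lambda>w. 0)"
    by (rule ext) (simp add: sharp_def)
  then have Div: "Div h (sharp h (\<lambda>w. 0)) z = 0"
    by (simp add: Div_def covd_def total_deriv_def pd_def)
  show ?thesis
    unfolding hamiltonian_op_def curl Div by simp
qed

section \<open>Conservation, nontriviality and kernel condition for \<rho> F(S)\<close>

context
  fixes A :: "('m::topological_space, 'n::finite) chart set"
    and g :: "('m, 'n) chart \<Rightarrow> real^'n \<Rightarrow> real^'n^'n"
    and F :: "real \<Rightarrow> real"
  assumes A: "smooth_atlas A" and g: "riemannian_metric A g" and F: "smooth_real F"
begin

lemma density_pd:
  "pd (Dens {#}) (\<lambda>z. dens z * F (entr z)) z = F (entr z)"
  "pd (Entr {#}) (\<lambda>z. dens z * F (entr z)) z = dens z * deriv F (entr z)"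
  "pd Time (\<lambda>z. dens z * F (entr z)) z = 0"
  "pd (Vel i {#}) (\<lambda>z. dens z * F (entr z)) z = 0"
proof -
  have pd: "pd a (\<lambda>z. dens z * F (entr z)) z = (if a = Dens {#} then F (entr z)
      else if a = Entr {#} then dens z * deriv F (entr z) else 0)" for a
    using pd_eqI[OF pd_density[OF F smooth_real_const[of 0], where z = z and a = a]] by simp
  show "pd (Dens {#}) (\<lambda>z. dens z * F (entr z)) z = F (entr z)"
    "pd (Entr {#}) (\<lambda>z. dens z * F (entr z)) z = dens z * deriv F (entr z)"
    "pd Time (\<lambda>z. dens z * F (entr z)) z = 0"
    "pd (Vel i {#}) (\<lambda>z. dens z * F (entr z)) z = 0"
    unfolding pd by simp_all
qed

lemma density_kinematic: "kinematic_density A (\<lambda>c z. dens z * F (entr z))"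
  unfolding kinematic_density_def scalar_function_def
proof (intro conjI ballI allI impI)
  fix c :: "('m, 'n) chart"
  show "smooth_jet (jet_dom c) (\<lambda>z. dens z * F (entr z))"
    using smooth_jet_density[OF F smooth_real_const[of 0], of "jet_dom c"] by simp
  show "\<exists>k. depends_only_on (jet_dom c) {a. coord_order a \<le> k} (\<lambda>z. dens z * F (entr z))"
    by (rule exI[of _ 0]) (simp add: depends_only_on_def dens_def entr_def)
  show "depends_only_on (jet_dom c) {a. coord_order a = 0} (\<lambda>z. dens z * F (entr z))"
    by (simp add: depends_only_on_def dens_def entr_def)
qed (simp add: same_fields_def dens_def entr_def jet_of_def)

text \<open>Both kinds of triviality fail. At fixed entropy \<open>s\<close> the density is linear
  in \<open>dens\<close> with slope \<open>F s\<close>, which is visible at a single point and which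
  \<open>divergence_not_affine_in_density\<close> excludes for a total divergence.\<close>

lemma density_nontrivial:
  assumes "F s \<noteq> 0"
  shows "\<not> trivial_density A g (\<lambda>c z. dens z * F (entr z))"
proof
  assume triv: "trivial_density A g (\<lambda>c z. dens z * F (entr z))"
  obtain c p where c: "c \<in> A" and p: "p \<in> fst c"
    using A unfolding smooth_atlas_def by blast
  define x where "x = snd c p"
  have x: "x \<in> chart_image c"
    using p by (simp add: x_def chart_image_def)
  \<comment> \<open>The jets with densities 1 and 2 share time and position, but the conserved
    density takes the values \<open>F s\<close> and \<open>2 * F s\<close> there.\<close>
  define z :: "real \<Rightarrow> 'n jet" where
    "z \<rho> a = (case a of Space i \<Rightarrow> x $ i | Dens \<alpha> \<Rightarrow> \<rho> | Entr \<alpha> \<Rightarrow> s | _ \<Rightarrow> 0)" for \<rho> a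
  have z: "pos (z \<rho>) = x" "dens (z \<rho>) = \<rho>" "entr (z \<rho>) = s" for \<rho>
    by (simp_all add: z_def pos_def dens_def entr_def vec_eq_iff)
  have "\<not> depends_only_on (jet_dom c) (insert Time (range Space)) (\<lambda>z. dens z * F (entr z))"
  proof
    assume "depends_only_on (jet_dom c) (insert Time (range Space)) (\<lambda>z. dens z * F (entr z))"
    moreover have "z 1 \<in> jet_dom c" "z 2 \<in> jet_dom c"
      using x by (auto simp: jet_dom_def z)
    moreover have "\<forall>a\<in>insert Time (range Space). z 1 a = z 2 a"
      by (auto simp: z_def)
    ultimately have "dens (z 1) * F (entr (z 1)) = dens (z 2) * F (entr (z 2))"
      unfolding depends_only_on_def by blast
    then show False
      using assms by (simp add: z)
  qed
  then obtain \<Theta> where \<Theta>: "vector_function A \<Theta>"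
    and eq: "\<And>z. z \<in> jet_dom c \<Longrightarrow> dens z * F (entr z) = Div (g c) (\<Theta> c) z"
    using triv c unfolding trivial_density_def by blast
  obtain k where k: "depends_only_on (jet_dom c) {a. coord_order a \<le> k} (\<Theta> c)"
    using \<Theta> c unfolding vector_function_def by blast
  have smooth: "smooth_jet (jet_dom c) (\<lambda>z. \<Theta> c z $ i)" for i
    using \<Theta> c unfolding vector_function_def by blast
  have "F s = 0"
    by (rule divergence_not_affine_in_density[OF riemannian_metric_on[OF g c] smooth_atlas_open[OF A c]
          smooth k smooth_atlas_open[OF A c] x order_refl, where s = s and t = 0])
      (simp add: eq[symmetric] algebra_simps)
  with assms show False ..
qed

text \<open>The flux beyond T u is 0: the balance is \<open>F\<close> times the continuity equation
  plus \<open>dens z * deriv F (entr z)\<close> times the transport equation of entropy.\<close>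

lemma density_conserved:
  fixes z :: "'n jet"
  assumes "fluid_equations h P z ut rt st"
  shows "total_time_deriv (\<lambda>z. dens z * F (entr z)) z ut rt st =
    - Div h (\<lambda>w. (dens w * F (entr w)) *\<^sub>R vel w + 0) z"
proof -
  have dv: "jet_differentiable (\<lambda>w. dens w * vel w $ i) z" for i
    by (intro jet_differentiable_mult jet_differentiable_dens jet_differentiable_vel)
  have F': "(F has_real_derivative deriv F (entr z)) (at (entr z))"
    by (rule smooth_real_has_derivative[OF F])
  have "total_deriv i (\<lambda>w. (dens w * F (entr w)) * vel w $ i) z =
      deriv F (entr z) * total_deriv i entr z * (dens z * vel z $ i) +
      F (entr z) * total_deriv i (\<lambda>w. dens w * vel w $ i) z" for i
  proof -
    have "(\<lambda>w. (dens w * F (entr w)) * vel w $ i) = (\<lambda>w. F (entr w) * (dens w * vel w $ i))"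
      by (simp add: fun_eq_iff)
    then show ?thesis
      using total_deriv_mult[OF jet_differentiable_compose[OF F' jet_differentiable_entr] dv, of i i]
        total_deriv_compose[OF F' jet_differentiable_entr, of i] by simp
  qed
  then have "Div h (\<lambda>w. (dens w * F (entr w)) *\<^sub>R vel w + 0) z =
      F (entr z) * Div h (\<lambda>w. dens w *\<^sub>R vel w) z +
      deriv F (entr z) * dens z * (\<Sum>i\<in>UNIV. vel z $ i * total_deriv i entr z)"
    by (simp add: Div_eq_contraction sum.distrib sum_distrib_left algebra_simps)
  moreover have "rt = - Div h (\<lambda>w. dens w *\<^sub>R vel w) z"
    "st = - (\<Sum>j\<in>UNIV. vel z $ j * total_deriv j entr z)"
    using assms unfolding fluid_equations_def by auto
  ultimately show ?thesis
    by (simp add: total_time_deriv_def density_pd algebra_simps)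
qed

text \<open>The derivative in density is F(S), whose gradient is \<open>deriv F\<close> times the
  entropy gradient. It cancels the entropy term once the factor \<open>dens z\<close> is divided
  out.\<close>

lemma density_casimir_kernel:
  fixes z :: "'n jet"
  assumes "dens z > 0"
  shows "hamiltonian_op h (\<lambda>w. \<chi> i. pd (Vel i {#}) (\<lambda>z. dens z * F (entr z)) w)
    (pd (Dens {#}) (\<lambda>z. dens z * F (entr z))) (pd (Entr {#}) (\<lambda>z. dens z * F (entr z))) z = 0"
proof -
  have "(\<lambda>w. \<chi> i. pd (Vel i {#}) (\<lambda>z. dens z * F (entr z)) w) = (\<lambda>w. 0 :: real^'n)"
    by (simp add: density_pd vec_eq_iff fun_eq_iff)
  moreover have "pd (Dens {#}) (\<lambda>z. dens z * F (entr z)) = (\<lambda>z :: 'n jet. F (entr z))"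
    by (simp add: density_pd fun_eq_iff)
  moreover have "Grad h (\<lambda>z. F (entr z)) z = deriv F (entr z) *\<^sub>R Grad h entr z"
  proof -
    have "total_deriv j (\<lambda>z. F (entr z)) z = deriv F (entr z) * total_deriv j entr z" for j
      by (rule total_deriv_compose[OF smooth_real_has_derivative[OF F] jet_differentiable_entr])
    then have "(\<chi> j. total_deriv j (\<lambda>z. F (entr z)) z) = deriv F (entr z) *\<^sub>R (\<chi> j. total_deriv j entr z)"
      by (simp add: vec_eq_iff)
    then show ?thesis
      unfolding Grad_def sharp_def by (simp only: matrix_vector_mult_scaleR)
  qed
  ultimately show ?thesis
    using assms by (simp only: hamiltonian_op_zero) (simp add: density_pd prod_eq_iff)
qed

lemma density_casimir:
  assumes "F s \<noteq> 0"
  shows "casimir_density A g P (\<lambda>c z. dens z * F (entr z))"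
  unfolding casimir_density_def kinematic_conserved_density_def
proof (intro conjI exI[of _ "\<lambda>c z. 0"] ballI allI impI)
  show "vector_function A (\<lambda>c (z :: 'n jet). 0 :: real^'n)"
    by (simp add: vector_function_def smooth_jet_const depends_only_on_def)
  show "kinematic_density A (\<lambda>c z. dens z * F (entr z))"
    by (rule density_kinematic)
  show "\<not> trivial_density A g (\<lambda>c z. dens z * F (entr z))"
    by (rule density_nontrivial[OF assms])
next
  fix c z ut rt st
  assume "fluid_equations (g c) P z ut rt st"
  then show "total_time_deriv (\<lambda>z. dens z * F (entr z)) z ut rt st =
      - Div (g c) (\<lambda>w. (dens w * F (entr w)) *\<^sub>R vel w + 0) z"
    by (rule density_conserved)
next
  fix c :: "('m, 'n) chart" and z :: "'n jet"
  assume "z \<in> jet_dom c"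
  then show "hamiltonian_op (g c) (\<lambda>w. \<chi> i. pd (Vel i {#}) (\<lambda>z. dens z * F (entr z)) w)
      (pd (Dens {#}) (\<lambda>z. dens z * F (entr z))) (pd (Entr {#}) (\<lambda>z. dens z * F (entr z))) z = 0"
    by (intro density_casimir_kernel) (simp add: jet_dom_def)
qed

end


section \<open>Casimir densities in a single chart\<close>

lemma depends_only_on_mono: "depends_only_on U C F \<Longrightarrow> C \<subseteq> C' \<Longrightarrow> depends_only_on U C' F"
  unfolding depends_only_on_def by blast

text \<open>The admissible values of one non-spatial coordinate form a half line (for the density
  itself) or the whole line, so a vanishing derivative forces constancy. For a spatial coordinate
  they need not be connected, as a chart image may be any open set.\<close>

lemma depends_only_on_remove:
  assumes dep: "depends_only_on (jet_dom c) C F" and a: "a \<notin> range Space"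
    and deriv: "\<And>z. z \<in> jet_dom c \<Longrightarrow> ((\<lambda>s. F (z(a := s))) has_real_derivative 0) (at (z a))"
  shows "depends_only_on (jet_dom c) (C - {a}) F"
  unfolding depends_only_on_def
proof (intro ballI impI)
  fix z z' assume z: "z \<in> jet_dom c" "z' \<in> jet_dom c" and eq: "\<forall>b\<in>C - {a}. z b = z' b"
  define I where "I = {s. z(a := s) \<in> jet_dom c}"
  have "pos (z(a := s)) = pos z" for s
    using a by (auto simp: pos_def vec_eq_iff)
  then have I_eq: "I = (if a = Dens {#} then {0<..} else UNIV)"
    using z(1) by (auto simp: I_def jet_dom_def dens_def)
  have "convex I"
    by (simp add: I_eq)
  moreover have "((\<lambda>s. F (z(a := s))) has_real_derivative 0) (at s within I)" if "s \<in> I" for s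
  proof -
    have "z(a := s) \<in> jet_dom c"
      using that by (simp add: I_def)
    from deriv[OF this] show ?thesis
      by (simp add: has_field_derivative_at_within)
  qed
  ultimately have "\<exists>k. \<forall>s\<in>I. F (z(a := s)) = k"
    by (rule has_field_derivative_zero_constant)
  then obtain k where k: "\<And>s. s \<in> I \<Longrightarrow> F (z(a := s)) = k"
    by blast
  have "z a \<in> I"
    using z(1) by (simp add: I_def)
  moreover have "z' a \<in> I"
    using z(2) by (auto simp: I_eq jet_dom_def dens_def)
  ultimately have "F z = F (z(a := z' a))"
    using k[of "z a"] k[of "z' a"] by simp
  also have "\<dots> = F z'"
  proof -
    have "\<forall>b\<in>C. (z(a := z' a)) b = z' b"
      using eq by auto
    moreover have "z(a := z' a) \<in> jet_dom c"
      using \<open>z' a \<in> I\<close> by (simp add: I_def)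
    ultimately show ?thesis
      using dep z(2) unfolding depends_only_on_def by blast
  qed
  finally show "F z = F z'" .
qed

lemma depends_only_on_remove_finite:
  assumes "finite B" "depends_only_on (jet_dom c) C F" "B \<inter> range Space = {}"
    and "\<And>a z. a \<in> B \<Longrightarrow> z \<in> jet_dom c \<Longrightarrow> ((\<lambda>s. F (z(a := s))) has_real_derivative 0) (at (z a))"
  shows "depends_only_on (jet_dom c) (C - B) F"
  using assms
proof (induction B rule: finite_induct)
  case (insert a B)
  have "depends_only_on (jet_dom c) (C - B - {a}) F"
  proof (rule depends_only_on_remove)
    show "depends_only_on (jet_dom c) (C - B) F"
    proof (rule insert.IH)
      show "((\<lambda>s. F (z(a := s))) has_real_derivative 0) (at (z a))" if "a \<in> B" "z \<in> jet_dom c" for a z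
        by (rule insert.prems(3)[OF insertI2[OF that(1)] that(2)])
    qed (use insert.prems(1,2) in auto)
    show "((\<lambda>s. F (z(a := s))) has_real_derivative 0) (at (z a))" if "z \<in> jet_dom c" for z
      by (rule insert.prems(3)[OF insertI1 that])
    show "a \<notin> range Space"
      using insert.prems(2) by blast
  qed
  then show ?case
    unfolding Diff_insert[of C a B] .
qed simp

lemma coord_order_0:
  "{a :: 'n coord. coord_order a = 0} =
     insert Time (insert (Dens {#}) (insert (Entr {#}) (range Space \<union> range (\<lambda>i. Vel i {#}))))"
proof (intro set_eqI iffI)
  fix a :: "'n coord"
  assume "a \<in> {a. coord_order a = 0}"
  then show "a \<in> insert Time (insert (Dens {#}) (insert (Entr {#}) (range Space \<union> range (\<lambda>i. Vel i {#}))))"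
    by (cases a) auto
qed auto

text \<open>At a fixed point of order zero, the gradients of density and entropy may be prescribed
  arbitrarily and the velocity gradient may be taken to vanish.\<close>

definition with_gradients :: "'n jet \<Rightarrow> ('n \<Rightarrow> real) \<Rightarrow> ('n \<Rightarrow> real) \<Rightarrow> 'n jet" where
  "with_gradients z r v a = (if coord_order a = 0 then z a else
     case a of Dens \<alpha> \<Rightarrow> r (SOME j. j \<in># \<alpha>) | Entr \<alpha> \<Rightarrow> v (SOME j. j \<in># \<alpha>) | _ \<Rightarrow> 0)"

lemma with_gradients_simps:
  "coord_order a = 0 \<Longrightarrow> with_gradients z r v a = z a"
  "with_gradients z r v (Vel i {#j#}) = 0"
  "with_gradients z r v (Dens {#j#}) = r j"
  "with_gradients z r v (Entr {#j#}) = v j"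
  by (simp_all add: with_gradients_def)

lemma with_gradients_dom: "z \<in> jet_dom c \<Longrightarrow> with_gradients z r v \<in> jet_dom c"
  by (simp add: jet_dom_def pos_def dens_def with_gradients_simps)

lemma total_deriv_order_0:
  fixes F :: "'n::finite jet \<Rightarrow> real"
  assumes "open U" "z \<in> U" "depends_only_on U {a. coord_order a = 0} F"
  shows "total_deriv j F z = pd (Space j) F z + (\<Sum>i\<in>UNIV. z (Vel i {#j#}) * pd (Vel i {#}) F z) +
    z (Dens {#j#}) * pd (Dens {#}) F z + z (Entr {#j#}) * pd (Entr {#}) F z"
proof -
  have fin: "finite {a :: 'n coord. coord_order a = 0}"
    using coord_order_finite[of 0] by simp
  have "total_deriv j F z = (\<Sum>a\<in>{a. coord_order a = 0}. shift j z a * pd a F z)"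
    using pd_outside[OF assms] by (intro total_deriv_eq_sum fin) blast
  also have "\<dots> = (\<Sum>a\<in>range Space. shift j z a * pd a F z) +
      (\<Sum>a\<in>range (\<lambda>i. Vel i {#}). shift j z a * pd a F z) +
      z (Dens {#j#}) * pd (Dens {#}) F z + z (Entr {#j#}) * pd (Entr {#}) F z"
  proof -
    have "(\<Sum>a\<in>{a. coord_order a = 0}. f a) = f Time + (f (Dens {#}) + (f (Entr {#}) +
        ((\<Sum>a\<in>range Space. f a) + (\<Sum>a\<in>range (\<lambda>i. Vel i {#}). f a))))" for f :: "'n coord \<Rightarrow> real"
    proof -
      have "sum f (range Space \<union> range (\<lambda>i. Vel i {#})) =
          sum f (range Space) + sum f (range (\<lambda>i. Vel i {#}))"
        by (rule sum.union_disjoint) auto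
      moreover have "Time \<notin> insert (Dens {#}) (insert (Entr {#}) (range Space \<union> range (\<lambda>i :: 'n. Vel i {#})))"
        "Dens {#} \<notin> insert (Entr {#}) (range Space \<union> range (\<lambda>i :: 'n. Vel i {#}))"
        "Entr {#} \<notin> range Space \<union> range (\<lambda>i :: 'n. Vel i {#})"
        by auto
      ultimately show ?thesis
        unfolding coord_order_0 by (simp only: sum.insert finite_insert finite_Un finite_imageI finite simp_thms)
    qed
    from this[of "\<lambda>a. shift j z a * pd a F z"] show ?thesis
      by simp
  qed
  also have "(\<Sum>a\<in>range Space. shift j z a * pd a F z) = pd (Space j) F z"
  proof -
    have "(\<Sum>a\<in>range Space. shift j z a * pd a F z) = (\<Sum>i\<in>UNIV. shift j z (Space i) * pd (Space i) F z)"
      by (subst sum.reindex) (auto simp: inj_on_def)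
    also have "\<dots> = (\<Sum>i\<in>UNIV. if i = j then pd (Space i) F z else 0)"
      by (intro sum.cong) auto
    finally show ?thesis
      by simp
  qed
  also have "(\<Sum>a\<in>range (\<lambda>i. Vel i {#}). shift j z a * pd a F z) =
      (\<Sum>i\<in>UNIV. z (Vel i {#j#}) * pd (Vel i {#}) F z)"
    by (subst sum.reindex) (auto simp: inj_on_def)
  finally show ?thesis
    by simp
qed

section \<open>Consequences of the kernel condition and of the conservation law\<close>

context
  fixes c :: "('m, 'n::finite) chart" and h :: "real^'n \<Rightarrow> real^'n^'n"
    and T :: "'n jet \<Rightarrow> real"
  assumes opn: "open (chart_image c)" and h: "metric_on (chart_image c) h"
    and smooth: "smooth_jet (jet_dom c) T"
    and dep: "depends_only_on (jet_dom c) {a. coord_order a = 0} T"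
    and kernel: "\<And>z. z \<in> jet_dom c \<Longrightarrow>
      hamiltonian_op h (\<lambda>w. \<chi> i. pd (Vel i {#}) T w) (pd (Dens {#}) T) (pd (Entr {#}) T) z = 0"
begin

lemma dom_open: "open (jet_dom c)"
  by (rule open_jet_dom[OF opn])

lemma T_pd:
  assumes "z \<in> jet_dom c"
  shows "((\<lambda>s. T (z(a := s))) has_real_derivative pd a T z) (at (z a))"
    "((\<lambda>s. pd b T (z(a := s))) has_real_derivative pd a (pd b T) z) (at (z a))"
  by (rule smooth_jet_has_derivative[OF smooth assms],
      rule smooth_jet_has_derivative[OF smooth_jet_pd[OF smooth] assms])

lemma pd_at_with_gradients:
  assumes "z \<in> jet_dom c" "depends_only_on (jet_dom c) {a. coord_order a = 0} F"
  shows "F (with_gradients z r v) = F z" "pd a F (with_gradients z r v) = pd a F z"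
proof -
  have "\<forall>a\<in>{a. coord_order a = 0}. with_gradients z r v a = z a"
    by (simp add: with_gradients_simps)
  then show "F (with_gradients z r v) = F z" "pd a F (with_gradients z r v) = pd a F z"
    using assms(2) pd_depends_only_on[OF dom_open assms(2), of a] with_gradients_dom[OF assms(1), of r v] assms(1)
    unfolding depends_only_on_def by blast+
qed

lemma kernel_velocity_independent:
  assumes "z \<in> jet_dom c"
  shows "pd (Vel i {#}) T z = 0"
proof -
  define a :: "real^'n" where "a = (\<chi> i. pd (Vel i {#}) T z)"
  define H where "H = h (pos z)"
  have H: "invertible H"
    using metric_on_invertible[OF h] assms by (simp add: H_def jet_dom_def)
  \<comment> \<open>The entropy gradient is chosen so that raising its index gives \<open>a\<close>
    itself; the last component of the kernel condition then reads
    \<open>a \<bullet> a = 0\<close>.\<close>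
  define z' where "z' = with_gradients z (\<lambda>j. 0) (\<lambda>j. (H *v a) $ j)"
  have z': "z' \<in> jet_dom c"
    unfolding z'_def by (rule with_gradients_dom[OF assms])
  have [simp]: "pd (Vel i {#}) T z' = a $ i" for i
    unfolding z'_def a_def using pd_at_with_gradients(2)[OF assms dep] by simp
  have "pos z' = pos z"
    by (simp add: z'_def pos_def with_gradients_simps)
  moreover have "(\<chi> j. total_deriv j entr z') = H *v a"
    by (simp add: total_deriv_entr z'_def with_gradients_simps vec_eq_iff)
  ultimately have "Grad h entr z' = matrix_inv H *v (H *v a)"
    by (simp add: Grad_def sharp_def H_def)
  also have "\<dots> = a"
    by (simp add: matrix_vector_mul_assoc matrix_inv_right_left[OF H])
  finally have "Grad h entr z' = a" .
  moreover have "(\<Sum>i\<in>UNIV. Grad h entr z' $ i * pd (Vel i {#}) T z') = 0"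
    using kernel[OF z'] z' by (auto simp: hamiltonian_op_def prod_eq_iff jet_dom_def)
  ultimately have "a \<bullet> a = 0"
    by (simp add: inner_vec_def)
  then have "a = 0"
    by simp
  then show ?thesis
    by (simp add: a_def vec_eq_iff)
qed

lemma depends_only_thermodynamic:
  "depends_only_on (jet_dom c) (insert Time (insert (Dens {#}) (insert (Entr {#}) (range Space)))) T"
proof -
  have "depends_only_on (jet_dom c) ({a. coord_order a = 0} - range (\<lambda>i. Vel i {#})) T"
  proof (rule depends_only_on_remove_finite[OF _ dep])
    fix a z assume a: "a \<in> range (\<lambda>i :: 'n. Vel i {#})" and z: "z \<in> jet_dom c"
    then have "pd a T z = 0"
      using kernel_velocity_independent[OF z] by auto
    then show "((\<lambda>s. T (z(a := s))) has_real_derivative 0) (at (z a))"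
      using T_pd(1)[OF z, of a] by simp
  qed auto
  then show ?thesis
    by (rule depends_only_on_mono) (auto simp: coord_order_0)
qed

lemma kernel_density_slope:
  assumes "z \<in> jet_dom c"
  shows "pd (Space j) (pd (Dens {#}) T) z = 0" "pd (Dens {#}) (pd (Dens {#}) T) z = 0"
    "pd (Entr {#}) T z = dens z * pd (Entr {#}) (pd (Dens {#}) T) z"
proof -
  define b where "b = pd (Dens {#}) T"
  have dep_b: "depends_only_on (jet_dom c) (insert Time (insert (Dens {#}) (insert (Entr {#}) (range Space)))) b"
    unfolding b_def by (rule pd_depends_only_on[OF dom_open depends_only_thermodynamic])
  then have dep_b0: "depends_only_on (jet_dom c) {a. coord_order a = 0} b"
    by (rule depends_only_on_mono) (auto simp: coord_order_0)
  have b_vel: "pd (Vel i {#}) b w = 0" if "w \<in> jet_dom c" for i w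
    using pd_outside[OF dom_open that dep_b] by auto
  define H where "H = h (pos z)"
  have H: "invertible H"
    using metric_on_invertible[OF h] assms by (simp add: H_def jet_dom_def)
  \<comment> \<open>Both sides are affine in the free gradients \<open>r\<close> and
    \<open>v\<close>, so coefficients may be compared. The curl term drops out because
    \<open>T\<close> has no velocity derivative.\<close>
  have key: "pd (Space j) b z + r j * pd (Dens {#}) b z + v j * pd (Entr {#}) b z =
      pd (Entr {#}) T z / dens z * v j" for r v and j :: 'n
  proof -
    define z' where "z' = with_gradients z r v"
    have z': "z' \<in> jet_dom c"
      unfolding z'_def by (rule with_gradients_dom[OF assms])
    have dens: "dens z' = dens z" and pos: "pos z' = pos z"
      by (simp_all add: z'_def dens_def pos_def with_gradients_simps)
    have [simp]: "pd a b z' = pd a b z" "pd a T z' = pd a T z" for a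
      unfolding z'_def
      by (rule pd_at_with_gradients(2)[OF assms dep_b0], rule pd_at_with_gradients(2)[OF assms dep])
    have grad: "z' (Vel i {#j#}) = 0" "z' (Dens {#j#}) = r j" "z' (Entr {#j#}) = v j" for i
      by (simp_all add: z'_def with_gradients_simps)
    have "(\<chi> i. (1 / dens z') * (\<Sum>j\<in>UNIV. curl_vel h i j z' * (\<chi> i. pd (Vel i {#}) T z') $ j)) = 0"
      using kernel_velocity_independent[OF z'] by (simp add: vec_eq_iff)
    then have "Grad h b z' = (pd (Entr {#}) T z / dens z) *\<^sub>R Grad h entr z'"
      using kernel[OF z'] unfolding hamiltonian_op_def b_def[symmetric] by (simp add: prod_eq_iff dens)
    then have "matrix_inv H *v (\<chi> j. total_deriv j b z') =
        matrix_inv H *v ((pd (Entr {#}) T z / dens z) *\<^sub>R (\<chi> j. total_deriv j entr z'))"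
      by (simp add: Grad_def sharp_def pos H_def matrix_vector_mult_scaleR)
    then have "H *v (matrix_inv H *v (\<chi> j. total_deriv j b z')) =
        H *v (matrix_inv H *v ((pd (Entr {#}) T z / dens z) *\<^sub>R (\<chi> j. total_deriv j entr z')))"
      by (rule arg_cong)
    then have "(\<chi> j. total_deriv j b z') = (pd (Entr {#}) T z / dens z) *\<^sub>R (\<chi> j. total_deriv j entr z')"
      by (simp add: matrix_vector_mul_assoc matrix_inv_right_left[OF H])
    then have "total_deriv j b z' = pd (Entr {#}) T z / dens z * total_deriv j entr z'"
      by (simp add: vec_eq_iff)
    moreover have "total_deriv j entr z' = v j"
      by (simp add: total_deriv_entr grad)
    moreover have "total_deriv j b z' = pd (Space j) b z + r j * pd (Dens {#}) b z + v j * pd (Entr {#}) b z"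
      using total_deriv_order_0[OF dom_open z' dep_b0, of j] by (simp add: grad)
    ultimately show ?thesis
      by simp
  qed
  \<comment> \<open>The values (0, 0), (1, 0) and (0, 1) for (r, v) isolate the three
    coefficients.\<close>
  have space: "pd (Space j) b z = 0" for j
    using key[of j "\<lambda>_. 0" "\<lambda>_. 0"] by simp
  then show "pd (Space j) (pd (Dens {#}) T) z = 0"
    by (simp add: b_def)
  show "pd (Dens {#}) (pd (Dens {#}) T) z = 0"
    using key[of j "\<lambda>_. 1" "\<lambda>_. 0"] space[of j] by (simp add: b_def)
  have "pd (Entr {#}) b z = pd (Entr {#}) T z / dens z"
    using key[of j "\<lambda>_. 0" "\<lambda>_. 1"] space[of j] by simp
  then show "pd (Entr {#}) T z = dens z * pd (Entr {#}) (pd (Dens {#}) T) z"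
    using assms by (simp add: b_def jet_dom_def)
qed

lemma depends_only_slope:
  "depends_only_on (jet_dom c) (insert Time (insert (Entr {#}) (range Space))) (pd (Dens {#}) T)"
proof -
  have "depends_only_on (jet_dom c)
      (insert Time (insert (Dens {#}) (insert (Entr {#}) (range Space))) - {Dens {#}}) (pd (Dens {#}) T)"
  proof (rule depends_only_on_remove)
    show "((\<lambda>s. pd (Dens {#}) T (z(Dens {#} := s))) has_real_derivative 0) (at (z (Dens {#})))"
      if "z \<in> jet_dom c" for z
      using T_pd(2)[OF that, of "Dens {#}" "Dens {#}"] kernel_density_slope(2)[OF that] by simp
  qed (auto intro: pd_depends_only_on[OF dom_open depends_only_thermodynamic])
  then show ?thesis
    by (rule depends_only_on_mono) auto
qed

text \<open>The density drops out because the slope does not depend on it; the entropy drops out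
  because \<open>pd (Entr {#}) T\<close> is \<open>dens z\<close> times the entropy derivative of
  the slope.\<close>

lemma depends_only_remainder:
  "depends_only_on (jet_dom c) (insert Time (range Space)) (\<lambda>z. T z - dens z * pd (Dens {#}) T z)"
proof -
  let ?C = "insert Time (insert (Dens {#}) (insert (Entr {#}) (range Space :: 'n coord set)))"
  define R where "R z = T z - dens z * pd (Dens {#}) T z" for z
  have "depends_only_on (jet_dom c) ?C (pd (Dens {#}) T)"
    by (rule pd_depends_only_on[OF dom_open depends_only_thermodynamic])
  then have "depends_only_on (jet_dom c) ?C R"
  proof -
    assume dep_b: "depends_only_on (jet_dom c) ?C (pd (Dens {#}) T)"
    show ?thesis
      unfolding depends_only_on_def
    proof (intro ballI impI)
      fix z z' assume z: "z \<in> jet_dom c" "z' \<in> jet_dom c" "\<forall>a\<in>?C. z a = z' a"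
      have "T z = T z'" "pd (Dens {#}) T z = pd (Dens {#}) T z'"
        using z dep_b depends_only_thermodynamic unfolding depends_only_on_def by blast+
      moreover have "dens z = dens z'"
        using z(3) by (simp add: dens_def)
      ultimately show "R z = R z'"
        by (simp add: R_def)
    qed
  qed
  then have "depends_only_on (jet_dom c) (?C - {Dens {#}, Entr {#}}) R"
  proof (rule depends_only_on_remove_finite[rotated])
    fix a :: "'n coord" and z assume a: "a \<in> {Dens {#}, Entr {#}}" and z: "z \<in> jet_dom c"
    have "((\<lambda>s. dens (z(a := s))) has_real_derivative (if a = Dens {#} then 1 else 0)) (at (z a))"
      by (simp add: dens_def)
    from DERIV_diff[OF T_pd(1)[OF z] DERIV_mult[OF this T_pd(2)[OF z, of "Dens {#}"]]]
    have "((\<lambda>s. R (z(a := s))) has_real_derivative pd a T z -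
        ((if a = Dens {#} then 1 else 0) * pd (Dens {#}) T z + pd a (pd (Dens {#}) T) z * dens z)) (at (z a))"
      by (simp add: R_def)
    moreover have "pd a T z - ((if a = Dens {#} then 1 else 0) * pd (Dens {#}) T z +
        pd a (pd (Dens {#}) T) z * dens z) = 0"
      using a kernel_density_slope(2,3)[OF z] by auto
    ultimately show "((\<lambda>s. R (z(a := s))) has_real_derivative 0) (at (z a))"
      by simp
  qed auto
  then show ?thesis
    unfolding R_def[abs_def] by (rule depends_only_on_mono) auto
qed

text \<open>Position cannot be dropped coordinate by coordinate, since a chart image need not be
  connected along an axis. Along a segment inside it, vanishing spatial derivatives do give
  constancy.\<close>

lemma slope_constant_along_segment:
  assumes z: "z \<in> jet_dom c" "z' \<in> jet_dom c" and eq: "z Time = z' Time" "entr z = entr z'"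
    and seg: "closed_segment (pos z) (pos z') \<subseteq> chart_image c"
  shows "pd (Dens {#}) T z = pd (Dens {#}) T z'"
proof -
  define b where "b = pd (Dens {#}) T"
  define C where "C = insert Time (insert (Entr {#}) (range (Space :: 'n \<Rightarrow> 'n coord)))"
  have dep_b: "depends_only_on (jet_dom c) C b"
    unfolding b_def C_def by (rule depends_only_slope)
  have smooth_b: "smooth_jet (jet_dom c) b"
    unfolding b_def by (rule smooth_jet_pd[OF smooth])
  \<comment> \<open>Only the position moves. The density stays that of \<open>z\<close>, which keeps
    the curve in the domain; its end differs from \<open>z'\<close> only in coordinates on which the
    slope does not depend.\<close>
  define \<gamma> :: "real \<Rightarrow> 'n jet" where
    "\<gamma> \<tau> a = (case a of Space i \<Rightarrow> z a + \<tau> * (z' a - z a) | _ \<Rightarrow> z a)" for \<tau> a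
  have pos: "pos (\<gamma> \<tau>) = pos z + \<tau> *\<^sub>R (pos z' - pos z)" for \<tau>
    by (simp add: \<gamma>_def pos_def vec_eq_iff)
  have dens: "dens (\<gamma> \<tau>) = dens z" for \<tau>
    by (simp add: \<gamma>_def dens_def)
  have dom_iff: "\<gamma> \<tau> \<in> jet_dom c \<longleftrightarrow> pos z + \<tau> *\<^sub>R (pos z' - pos z) \<in> chart_image c" for \<tau>
    using z(1) by (simp add: jet_dom_def pos dens)
  have in_dom: "\<gamma> \<tau> \<in> jet_dom c" if "\<tau> \<in> {0..1}" for \<tau>
  proof -
    have "pos z + \<tau> *\<^sub>R (pos z' - pos z) \<in> closed_segment (pos z) (pos z')"
      unfolding in_segment
    proof (intro exI conjI)
      show "pos z + \<tau> *\<^sub>R (pos z' - pos z) = (1 - \<tau>) *\<^sub>R pos z + \<tau> *\<^sub>R pos z'"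
        by (simp add: algebra_simps)
    qed (use that in auto)
    then show ?thesis
      using seg by (auto simp: dom_iff)
  qed
  have "((\<lambda>\<tau>. b (\<gamma> \<tau>)) has_real_derivative 0) (at \<tau> within {0..1})" if \<tau>: "\<tau> \<in> {0..1}" for \<tau>
  proof -
    define \<gamma>' where "\<gamma>' a = (case a of Space i \<Rightarrow> z' a - z a | _ \<Rightarrow> 0)" for a :: "'n coord"
    have \<gamma>': "((\<lambda>\<tau>. \<gamma> \<tau> a) has_real_derivative \<gamma>' a) (at \<tau>)" for a
      unfolding \<gamma>_def \<gamma>'_def by (cases a) (auto intro!: derivative_eq_intros)
    have near: "\<forall>\<^sub>F \<tau> in nhds \<tau>. \<gamma> \<tau> \<in> jet_dom c"
    proof -
      have "((\<lambda>\<tau>. pos z + \<tau> *\<^sub>R (pos z' - pos z)) \<longlongrightarrow> pos z + \<tau> *\<^sub>R (pos z' - pos z)) (nhds \<tau>)"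
        by (intro tendsto_intros filterlim_ident)
      from topological_tendstoD[OF this opn] show ?thesis
        using in_dom[OF \<tau>] by (simp add: dom_iff)
    qed
    have "((\<lambda>\<tau>. b (\<gamma> \<tau>)) has_real_derivative (\<Sum>a\<in>C. \<gamma>' a * pd a b (\<gamma> \<tau>))) (at \<tau>)"
      by (rule chain_rule_jet[where \<gamma> = \<gamma> and t = \<tau>,
            OF dom_open in_dom[OF \<tau>] near smooth_b _ dep_b \<gamma>']) (simp add: C_def)
    moreover have "(\<Sum>a\<in>C. \<gamma>' a * pd a b (\<gamma> \<tau>)) = 0"
      using kernel_density_slope(1)[OF in_dom[OF \<tau>]]
      by (intro sum.neutral) (auto simp: C_def \<gamma>'_def b_def)
    ultimately show ?thesis
      by (simp add: has_field_derivative_at_within)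
  qed
  from has_field_derivative_zero_constant[OF convex_real_interval(5) this]
  obtain k where "\<And>\<tau>. \<tau> \<in> {0..1} \<Longrightarrow> b (\<gamma> \<tau>) = k"
    by blast
  from this[of 0] this[of 1] have "b (\<gamma> 0) = b (\<gamma> 1)"
    by simp
  moreover have "\<gamma> 0 = z"
    by (auto simp: \<gamma>_def fun_eq_iff split: coord.split)
  moreover have "b (\<gamma> 1) = b z'"
  proof -
    have "\<forall>a\<in>C. \<gamma> 1 a = z' a"
      using eq by (auto simp: C_def \<gamma>_def entr_def)
    moreover have "\<gamma> 1 \<in> jet_dom c"
      by (rule in_dom) simp
    ultimately show ?thesis
      using dep_b z(2) unfolding depends_only_on_def by blast
  qed
  ultimately show ?thesis
    by (simp add: b_def)
qed

text \<open>When all velocity coordinates vanish, T u has zero divergence and the equations hold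
  with \<rho>_t = S_t = 0 and u_t given by the pressure gradient. This u_t does not enter the time
  derivative of \<open>T\<close>, which has no velocity derivative.\<close>

lemma conservation_at_rest:
  assumes smooth_\<Phi>: "\<And>i. smooth_jet (jet_dom c) (\<lambda>z. \<Phi> z $ i)"
    and dep_\<Phi>: "depends_only_on (jet_dom c) {a. coord_order a \<le> k} \<Phi>"
    and conserved: "\<And>z ut rt st. z \<in> jet_dom c \<Longrightarrow> fluid_equations h P z ut rt st \<Longrightarrow>
      total_time_deriv T z ut rt st = - Div h (\<lambda>w. T w *\<^sub>R vel w + \<Phi> w) z"
    and z: "z \<in> jet_dom c" "\<And>i \<alpha>. z (Vel i \<alpha>) = 0"
  shows "Div h \<Phi> z = - pd Time T z"
proof -
  have vel: "vel z = 0"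
    using z(2) by (simp add: vel_def vec_eq_iff)
  have "total_deriv j (\<lambda>w. vel w $ i) z = shift j z (Vel i {#})" for i j
    using total_deriv_coord[of j "Vel i {#}" z] by (simp add: vel_def)
  then have D_vel: "total_deriv j (\<lambda>w. vel w $ i) z = 0" for i j
    using z(2) by simp
  have rest: "total_deriv j (\<lambda>w. F w * vel w $ i) z = 0" if "jet_differentiable F z" for F i j
    using total_deriv_mult[OF that jet_differentiable_vel, of j i] D_vel vel by simp
  have T: "jet_differentiable T z"
    using coord_order_finite[of 0] by (intro smooth_jet_differentiable[OF smooth dom_open dep _ z(1)]) simp
  have "jet_differentiable (\<lambda>w. \<Phi> w $ i) z" for i
  proof (rule smooth_jet_differentiable[OF smooth_\<Phi> dom_open _ coord_order_finite z(1)])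
    show "depends_only_on (jet_dom c) {a. coord_order a \<le> k} (\<lambda>z. \<Phi> z $ i)"
      using dep_\<Phi> unfolding depends_only_on_def by metis
  qed
  from total_deriv_add[OF jet_differentiable_mult[OF T jet_differentiable_vel] this]
  have "total_deriv i (\<lambda>w. T w * vel w $ i + \<Phi> w $ i) z = total_deriv i (\<lambda>w. \<Phi> w $ i) z" for i
    using rest[OF T] by simp
  then have "Div h (\<lambda>w. T w *\<^sub>R vel w + \<Phi> w) z = Div h \<Phi> z"
    by (simp add: Div_eq_contraction vel)
  moreover have "Div h (\<lambda>w. dens w *\<^sub>R vel w) z = 0"
    using rest[OF jet_differentiable_dens] by (simp add: Div_eq_contraction vel)
  then have "fluid_equations h P z (- (1 / dens z) *\<^sub>R Grad h (pressure P) z) 0 0"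
    unfolding fluid_equations_def by (simp add: vel vec_eq_iff)
  from conserved[OF z(1) this]
  have "pd Time T z = - Div h (\<lambda>w. T w *\<^sub>R vel w + \<Phi> w) z"
    using kernel_velocity_independent[OF z(1)] by (simp add: total_time_deriv_def)
  ultimately show ?thesis
    by simp
qed

text \<open>At rest the divergence of the flux is \<open>- pd Time R\<close> minus
  \<open>dens\<close> times the time derivative of the slope. At fixed time, position and entropy
  this is affine in the density, so \<open>divergence_not_affine_in_density\<close> applies.\<close>

lemma slope_time_independent:
  assumes smooth_\<Phi>: "\<And>i. smooth_jet (jet_dom c) (\<lambda>z. \<Phi> z $ i)"
    and dep_\<Phi>: "depends_only_on (jet_dom c) {a. coord_order a \<le> k} \<Phi>"
    and conserved: "\<And>z ut rt st. z \<in> jet_dom c \<Longrightarrow> fluid_equations h P z ut rt st \<Longrightarrow>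
      total_time_deriv T z ut rt st = - Div h (\<lambda>w. T w *\<^sub>R vel w + \<Phi> w) z"
    and z: "z \<in> jet_dom c"
  shows "pd Time (pd (Dens {#}) T) z = 0"
proof -
  define b where "b = pd (Dens {#}) T"
  define R where "R z = T z - dens z * b z" for z
  have dep_R: "depends_only_on (jet_dom c) (insert Time (range Space)) R"
    unfolding R_def[abs_def] b_def by (rule depends_only_remainder)
  have T_time: "pd Time T w = pd Time R w + dens w * pd Time b w" if "w \<in> jet_dom c" for w
  proof -
    have "((\<lambda>s. T (w(Time := s)) - dens w * b (w(Time := s))) has_real_derivative
        pd Time T w - dens w * pd Time b w) (at (w Time))"
      unfolding b_def by (intro DERIV_diff DERIV_cmult T_pd[OF that])
    then have "((\<lambda>s. R (w(Time := s))) has_real_derivative pd Time T w - dens w * pd Time b w) (at (w Time))"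
      by (simp add: R_def dens_def)
    from pd_eqI[OF this] show ?thesis
      by simp
  qed
  have "pos z \<in> chart_image c"
    using z by (simp add: jet_dom_def)
  then obtain r where r: "r > 0" "ball (pos z) r \<subseteq> chart_image c"
    using opn open_contains_ball by blast
  \<comment> \<open>The divergence lemma needs one coefficient for all positions near
    \<open>z\<close>. Segments in a ball stay inside the chart, so the slopes at \<open>w\<close>
    and \<open>z\<close> agree at every time, and with them their time derivatives.\<close>
  have b_time: "pd Time b w = pd Time b z"
    if w: "w \<in> jet_dom c" "pos w \<in> ball (pos z) r" "w Time = z Time" "entr w = entr z" for w
  proof -
    have "b (w(Time := s)) = b (z(Time := s))" for s
      unfolding b_def
    proof (rule slope_constant_along_segment)
      have "closed_segment (pos w) (pos z) \<subseteq> ball (pos z) r"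
        using w(2) r(1) by (intro closed_segment_subset) auto
      moreover have "pos (w(Time := s)) = pos w" "pos (z(Time := s)) = pos z"
        by (simp_all add: pos_def)
      ultimately show "closed_segment (pos (w(Time := s))) (pos (z(Time := s))) \<subseteq> chart_image c"
        using r(2) by simp
    qed (use w z in \<open>simp_all add: jet_dom_def pos_def dens_def entr_def\<close>)
    then show ?thesis
      unfolding pd_def w(3) by simp
  qed
  have "- pd Time b z = 0"
  proof (rule divergence_not_affine_in_density[OF h opn smooth_\<Phi> dep_\<Phi> open_ball _ r(2)])
    show "pos z \<in> ball (pos z) r"
      using r(1) by simp
    fix z1 z2
    assume dom: "z1 \<in> jet_dom c" "z2 \<in> jet_dom c" and pos: "pos z1 \<in> ball (pos z) r" "pos z2 = pos z1"
      and time: "z1 Time = z Time" "z2 Time = z Time" and entr: "entr z1 = entr z" "entr z2 = entr z"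
      and vel: "\<And>i \<alpha>. z1 (Vel i \<alpha>) = 0" "\<And>i \<alpha>. z2 (Vel i \<alpha>) = 0"
    have "z1 (Space i) = z2 (Space i)" for i
      using arg_cong[OF pos(2), of "\<lambda>x. x $ i"] by (simp add: pos_def)
    then have "\<forall>a\<in>insert Time (range Space). z1 a = z2 a"
      using time by auto
    then have "pd Time R z1 = pd Time R z2"
      using pd_depends_only_on[OF dom_open dep_R, of Time] dom unfolding depends_only_on_def by blast
    moreover have "pd Time b z1 = pd Time b z" "pd Time b z2 = pd Time b z"
      using b_time dom pos time entr by simp_all
    ultimately show "Div h \<Phi> z2 - Div h \<Phi> z1 = - pd Time b z * (dens z2 - dens z1)"
      using conservation_at_rest[OF smooth_\<Phi> dep_\<Phi> conserved dom(1) vel(1)]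
        conservation_at_rest[OF smooth_\<Phi> dep_\<Phi> conserved dom(2) vel(2)] T_time dom
      by (simp add: algebra_simps)
  qed
  then show ?thesis
    by (simp add: b_def)
qed

lemma depends_only_slope_stationary:
  assumes smooth_\<Phi>: "\<And>i. smooth_jet (jet_dom c) (\<lambda>z. \<Phi> z $ i)"
    and dep_\<Phi>: "depends_only_on (jet_dom c) {a. coord_order a \<le> k} \<Phi>"
    and conserved: "\<And>z ut rt st. z \<in> jet_dom c \<Longrightarrow> fluid_equations h P z ut rt st \<Longrightarrow>
      total_time_deriv T z ut rt st = - Div h (\<lambda>w. T w *\<^sub>R vel w + \<Phi> w) z"
  shows "depends_only_on (jet_dom c) (insert (Entr {#}) (range Space)) (pd (Dens {#}) T)"
proof -
  have "depends_only_on (jet_dom c) (insert Time (insert (Entr {#}) (range Space)) - {Time}) (pd (Dens {#}) T)"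
  proof (rule depends_only_on_remove[OF depends_only_slope])
    show "((\<lambda>s. pd (Dens {#}) T (z(Time := s))) has_real_derivative 0) (at (z Time))"
      if "z \<in> jet_dom c" for z
      using T_pd(2)[OF that, of "Dens {#}" Time] slope_time_independent[OF assms that] by simp
  qed auto
  then show ?thesis
    by (rule depends_only_on_mono) auto
qed

end


section \<open>Passage between charts\<close>

lemma smooth_on_const:
  fixes U :: "(real^'n::finite) set"
  shows "smooth_on U (\<lambda>x. k)"
proof -
  have "Ck_on m U (\<lambda>x. k)" for m k
  proof (induction m arbitrary: k)
    case (Suc m)
    have "partial i (\<lambda>x :: real^'n. k) = (\<lambda>x. 0)" for i
      by (simp add: partial_def fun_eq_iff)
    then show ?case
      using Suc.IH[of 0] by simp
  qed simp
  then show ?thesis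
    by (simp add: smooth_on_def)
qed

lemma chart_homeomorphism:
  assumes "smooth_atlas A" "c \<in> A"
  shows "open (fst c)" "continuous_on (fst c) (snd c)"
    "continuous_on (chart_image c) (inv_into (fst c) (snd c))"
    "p \<in> fst c \<Longrightarrow> inv_into (fst c) (snd c) (snd c p) = p"
  using assms unfolding smooth_atlas_def homeomorphism_def by blast+

lemma open_overlap:
  assumes "smooth_atlas A" "c \<in> A" "c' \<in> A"
  shows "open (overlap c c')"
proof -
  have "overlap c c' = chart_image c \<inter> inv_into (fst c) (snd c) -` fst c'"
    using chart_homeomorphism(4)[OF assms(1,2)] by (force simp: overlap_def chart_image_def)
  then show ?thesis
    using continuous_open_preimage[OF chart_homeomorphism(3)[OF assms(1,2)] smooth_atlas_open[OF assms(1,2)]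
        chart_homeomorphism(1)[OF assms(1,3)]] by simp
qed

lemma transition_chart:
  assumes "smooth_atlas A" "c \<in> A" "p \<in> fst c"
  shows "transition c c' (snd c p) = snd c' p"
  by (simp add: transition_def chart_homeomorphism(4)[OF assms])

text \<open>Zero velocity and constant scalars have the same components in every chart, whatever the
  Jacobian. These fields still reach every density and entropy.\<close>

lemma same_fields_const:
  assumes A: "smooth_atlas A" "c \<in> A" "c' \<in> A" and "\<rho> > 0"
  shows "same_fields c c' (overlap c c') (\<lambda>_. 0) (\<lambda>_. \<rho>) (\<lambda>_. s) (\<lambda>_. 0) (\<lambda>_. \<rho>) (\<lambda>_. s)"
proof -
  have "transition c c' ` overlap c c' = overlap c' c"
    unfolding overlap_def image_image
    using transition_chart[OF A(1,2), of _ c'] by (intro image_cong) auto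
  then show ?thesis
    using open_overlap[OF A] open_overlap[OF A(1,3,2)] assms(4)
    by (simp add: same_fields_def smooth_fields_def smooth_on_const)
qed

definition const_jet :: "real \<Rightarrow> real \<Rightarrow> real \<Rightarrow> real^'n \<Rightarrow> 'n::finite jet" where
  "const_jet t \<rho> s x = jet_of t (\<lambda>_. 0) (\<lambda>_. \<rho>) (\<lambda>_. s) x"

lemma const_jet_simps:
  "const_jet t \<rho> s x Time = t" "const_jet t \<rho> s x (Space i) = x $ i"
  "pos (const_jet t \<rho> s x) = x" "dens (const_jet t \<rho> s x) = \<rho>" "entr (const_jet t \<rho> s x) = s"
  "const_jet t \<rho> s x (Dens {#}) = \<rho>" "const_jet t \<rho> s x (Entr {#}) = s"
  by (simp_all add: const_jet_def jet_of_def pos_def dens_def entr_def vec_eq_iff)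

lemma const_jet_dom: "\<rho> > 0 \<Longrightarrow> const_jet t \<rho> s x \<in> jet_dom c \<longleftrightarrow> x \<in> chart_image c"
  by (simp add: jet_dom_def const_jet_simps)

lemma scalar_function_const_jet:
  assumes "smooth_atlas A" "scalar_function A T" "c \<in> A" "c' \<in> A" "p \<in> fst c" "p \<in> fst c'" "\<rho> > 0"
  shows "T c' (const_jet t \<rho> s (snd c' p)) = T c (const_jet t \<rho> s (snd c p))"
proof -
  have "snd c p \<in> overlap c c'"
    using assms(5,6) by (simp add: overlap_def)
  with same_fields_const[OF assms(1,3,4,7), of s] assms(2-4)
  have "T c' (const_jet t \<rho> s (transition c c' (snd c p))) = T c (const_jet t \<rho> s (snd c p))"
    unfolding scalar_function_def const_jet_def by blast
  then show ?thesis
    by (simp add: transition_chart[OF assms(1,3,5)])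
qed

section \<open>From slopes in charts to one function of entropy\<close>

lemma smooth_real_slice:
  assumes "smooth_jet U G" "\<And>s. z(a := s) \<in> U"
  shows "smooth_real (\<lambda>s. G (z(a := s)))"
proof (rule smooth_real_coinduct[where X = "\<lambda>f. \<exists>G. f = (\<lambda>s. G (z(a := s))) \<and> smooth_jet U G"])
  fix f assume "\<exists>G. f = (\<lambda>s. G (z(a := s))) \<and> smooth_jet U G"
  then obtain G where f: "f = (\<lambda>s. G (z(a := s)))" and G: "smooth_jet U G"
    by blast
  have d: "(f has_real_derivative pd a G (z(a := s))) (at s)" for s
    using smooth_jet_has_derivative[OF G assms(2), of s a] by (simp add: f)
  then have "deriv f = (\<lambda>s. pd a G (z(a := s)))"
    by (intro ext DERIV_imp_deriv)
  then show "(\<forall>x. f differentiable (at x)) \<and> (\<exists>G. deriv f = (\<lambda>s. G (z(a := s))) \<and> smooth_jet U G)"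
    using d smooth_jet_pd[OF G, of a] real_differentiable_def by blast
qed (use assms(1) in blast)

lemma casimir_structure:
  fixes A :: "('m::topological_space, 'n::finite) chart set"
  assumes A: "smooth_atlas A" and conn: "connected (UNIV :: 'm set)"
    and g: "riemannian_metric A g" and T: "casimir_density A g P T"
  obtains f where "smooth_real f"
    and "\<And>c. c \<in> A \<Longrightarrow> depends_only_on (jet_dom c) (insert Time (range Space))
      (\<lambda>z. T c z - dens z * f (entr z))"
proof -
  \<comment> \<open>Time 0 and density 1 are reference values; the slope turns out to depend on
    neither.\<close>
  define b where "b c s x = pd (Dens {#}) (T c) (const_jet 0 1 s x)" for c s x
  have scalar: "scalar_function A T"
    using T unfolding casimir_density_def kinematic_conserved_density_def kinematic_density_def by blast
  obtain \<Phi> where \<Phi>: "vector_function A \<Phi>"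
    and conserved: "\<And>c z ut rt st. c \<in> A \<Longrightarrow> z \<in> jet_dom c \<Longrightarrow> fluid_equations (g c) P z ut rt st \<Longrightarrow>
      total_time_deriv (T c) z ut rt st = - Div (g c) (\<lambda>w. T c w *\<^sub>R vel w + \<Phi> c w) z"
    using T unfolding casimir_density_def kinematic_conserved_density_def by blast
  have smooth: "smooth_jet (jet_dom c) (T c)" if "c \<in> A" for c
    using scalar that unfolding scalar_function_def by blast
  have dep: "depends_only_on (jet_dom c) {a. coord_order a = 0} (T c)" if "c \<in> A" for c
    using T that
    unfolding casimir_density_def kinematic_conserved_density_def kinematic_density_def by blast
  have kernel: "hamiltonian_op (g c) (\<lambda>w. \<chi> i. pd (Vel i {#}) (T c) w)
      (pd (Dens {#}) (T c)) (pd (Entr {#}) (T c)) z = 0" if "c \<in> A" "z \<in> jet_dom c" for c z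
    using T that unfolding casimir_density_def by blast
  note facts = smooth_atlas_open[OF A] riemannian_metric_on[OF g] smooth dep kernel
  have slope: "pd (Dens {#}) (T c) z = b c (entr z) (pos z)" if c: "c \<in> A" and z: "z \<in> jet_dom c" for c z
  proof -
    have smooth_\<Phi>: "smooth_jet (jet_dom c) (\<lambda>z. \<Phi> c z $ i)" for i
      using \<Phi> c unfolding vector_function_def by blast
    obtain k where k: "depends_only_on (jet_dom c) {a. coord_order a \<le> k} (\<Phi> c)"
      using \<Phi> c unfolding vector_function_def by blast
    have "depends_only_on (jet_dom c) (insert (Entr {#}) (range Space)) (pd (Dens {#}) (T c))"
      by (rule depends_only_slope_stationary[OF facts[OF c] smooth_\<Phi> k conserved[OF c]])
    moreover have "\<forall>a\<in>insert (Entr {#}) (range Space). z a = const_jet 0 1 (entr z) (pos z) a"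
      by (auto simp: const_jet_simps entr_def pos_def)
    moreover have "const_jet 0 1 (entr z) (pos z) \<in> jet_dom c"
      using z by (simp add: const_jet_dom) (simp add: jet_dom_def)
    ultimately show ?thesis
      using z unfolding depends_only_on_def b_def by blast
  qed
  \<comment> \<open>\<open>scalar_function\<close> relates values of \<open>T\<close> in two charts,
    not its derivatives. Since \<open>T\<close> is affine in the density, the slope is a difference
    of two values.\<close>
  have b_difference: "b c s x = T c (const_jet 0 2 s x) - T c (const_jet 0 1 s x)"
    if c: "c \<in> A" and x: "x \<in> chart_image c" for c s x
  proof -
    have dom: "const_jet 0 2 s x \<in> jet_dom c" "const_jet 0 1 s x \<in> jet_dom c"
      using x by (simp_all add: const_jet_dom)
    have "\<forall>a\<in>insert Time (range Space). const_jet 0 2 s x a = const_jet 0 1 s x a"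
      by (auto simp: const_jet_simps)
    then have "T c (const_jet 0 2 s x) - 2 * b c s x = T c (const_jet 0 1 s x) - 1 * b c s x"
      using depends_only_remainder[OF facts[OF c]] dom slope[OF c dom(1)] slope[OF c dom(2)]
      unfolding depends_only_on_def by (metis const_jet_simps(3,4,5))
    then show ?thesis
      by simp
  qed
  have b_chart: "b c s (snd c p) = b c' s (snd c' p)"
    if "c \<in> A" "c' \<in> A" "p \<in> fst c" "p \<in> fst c'" for c c' s p
  proof -
    have "snd c p \<in> chart_image c" "snd c' p \<in> chart_image c'"
      using that by (simp_all add: chart_image_def)
    then show ?thesis
      using scalar_function_const_jet[OF A scalar that] that by (simp add: b_difference)
  qed
  have b_segment: "b c s x = b c s y" if c: "c \<in> A" and seg: "closed_segment x y \<subseteq> chart_image c" for c s x y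
    unfolding b_def
    by (rule slope_constant_along_segment[OF facts[OF c]])
      (use seg in \<open>auto simp: const_jet_dom const_jet_simps\<close>)
  have "\<exists>c. c \<in> A \<and> p \<in> fst c" for p
    using A unfolding smooth_atlas_def by blast
  \<comment> \<open>A chart chosen at each point turns the slopes into a function \<open>B s\<close>
    on the manifold; by agreement on overlaps the choice does not matter.\<close>
  then obtain \<kappa> where \<kappa>: "\<And>p. \<kappa> p \<in> A" "\<And>p. p \<in> fst (\<kappa> p)"
    by metis
  define B where "B s p = b (\<kappa> p) s (snd (\<kappa> p) p)" for s p
  have B: "B s p = b c s (snd c p)" if "c \<in> A" "p \<in> fst c" for s p c
    unfolding B_def by (rule b_chart[OF \<kappa>(1) that(1) \<kappa>(2) that(2)])
  have "B s p = B s q" for s p q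
  proof (rule connected_local_const[OF conn UNIV_I UNIV_I], intro ballI)
    fix p
    define c where "c = \<kappa> p"
    have c: "c \<in> A" "p \<in> fst c"
      using \<kappa> by (simp_all add: c_def)
    then have "snd c p \<in> chart_image c"
      by (simp add: chart_image_def)
    then obtain r where r: "r > 0" "ball (snd c p) r \<subseteq> chart_image c"
      using smooth_atlas_open[OF A c(1)] open_contains_ball by blast
    have "open (fst c \<inter> snd c -` ball (snd c p) r)"
      by (rule continuous_open_preimage[OF chart_homeomorphism(2,1)[OF A c(1)] open_ball])
    moreover have "p \<in> fst c \<inter> snd c -` ball (snd c p) r"
      using c r(1) by simp
    moreover have "B s p = B s q" if q: "q \<in> fst c \<inter> snd c -` ball (snd c p) r" for q
    proof -
      have "closed_segment (snd c p) (snd c q) \<subseteq> ball (snd c p) r"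
        using q r(1) by (intro closed_segment_subset) auto
      then have "b c s (snd c p) = b c s (snd c q)"
        using r(2) by (intro b_segment[OF c(1)]) blast
      then show ?thesis
        using B[OF c] B[OF c(1), of q] q by simp
    qed
    ultimately show "\<forall>\<^sub>F q in at p within UNIV. B s p = B s q"
      unfolding eventually_at_topological by blast
  qed
  then have b_global: "b c s (snd c p) = B s q" if "c \<in> A" "p \<in> fst c" for c s p q
    using B[OF that] by metis
  \<comment> \<open>Any point will do, and a type is never empty.\<close>
  define p0 :: 'm where "p0 = undefined"
  define c0 where "c0 = \<kappa> p0"
  define z0 :: "'n jet" where "z0 = const_jet 0 1 0 (snd c0 p0)"
  have c0: "c0 \<in> A" "p0 \<in> fst c0"
    using \<kappa> by (simp_all add: c0_def)
  have z0: "z0(Entr {#} := s) \<in> jet_dom c0" "pos (z0(Entr {#} := s)) = snd c0 p0"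
    "entr (z0(Entr {#} := s)) = s" for s
    using c0 by (auto simp: z0_def jet_dom_def chart_image_def const_jet_simps pos_def dens_def entr_def vec_eq_iff)
  \<comment> \<open>Written as a slice of the smooth slope in one chart, so that its smoothness is
    immediate; its values are those of \<open>B\<close>.\<close>
  define f where "f s = pd (Dens {#}) (T c0) (z0(Entr {#} := s))" for s
  have f: "f s = B s q" for s q
    unfolding f_def slope[OF c0(1) z0(1)] z0(2,3) by (rule b_global[OF c0])
  show thesis
  proof
    show "smooth_real f"
      unfolding f_def[abs_def] by (rule smooth_real_slice[OF smooth_jet_pd[OF smooth[OF c0(1)]] z0(1)])
    fix c assume c: "c \<in> A"
    have "pd (Dens {#}) (T c) z = f (entr z)" if "z \<in> jet_dom c" for z
    proof -
      obtain p where "p \<in> fst c" "pos z = snd c p"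
        using \<open>z \<in> jet_dom c\<close> by (auto simp: jet_dom_def chart_image_def)
      then show ?thesis
        unfolding slope[OF c that] using b_global[OF c, of p _ p0] f[of _ p0] by simp
    qed
    then have eq: "T c z - dens z * f (entr z) = T c z - dens z * pd (Dens {#}) (T c) z"
      if "z \<in> jet_dom c" for z
      using that by simp
    show "depends_only_on (jet_dom c) (insert Time (range Space)) (\<lambda>z. T c z - dens z * f (entr z))"
      using depends_only_remainder[OF facts[OF c]] eq unfolding depends_only_on_def by metis
  qed
qed

lemma smooth_nonconstant_iff: "smooth_nonconstant f \<longleftrightarrow> smooth_real f \<and> \<not> f constant_on UNIV"
  by (simp add: smooth_nonconstant_def smooth_real_def)


section \<open>Normal form by mass and volumetric entropy\<close>

theorem mainTheorem4:
  fixes A :: "('m::{t2_space, second_countable_topology}, 'n::finite) chart set"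
    and g :: "('m, 'n) chart \<Rightarrow> real^'n \<Rightarrow> real^'n^'n"
    and P :: "real \<Rightarrow> real \<Rightarrow> real"
  assumes "smooth_atlas A"
    and "connected (UNIV :: 'm set)"
    and "riemannian_metric A g"
    and "CARD('n) > 1"
    and "smooth_jet {z. dens z > 0} (pressure P :: 'n jet \<Rightarrow> real)"
    and "\<exists>r > 0. \<exists>s. deriv (\<lambda>r'. P r' s) r \<noteq> 0 \<or> deriv (\<lambda>s'. P r s') s \<noteq> 0"
  shows "(\<forall>T. casimir_density A g P T \<longrightarrow>
            (\<exists>c1 c2 f. smooth_nonconstant f \<and>
               same_integral A g T (\<lambda>c z. c1 * mass_density c z + c2 * entropy_density f c z))) \<and>
         (\<forall>c1 c2 f. smooth_nonconstant f \<and> (c1 \<noteq> 0 \<or> c2 \<noteq> 0) \<longrightarrow>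
            casimir_density A g P (\<lambda>c z. c1 * mass_density c z + c2 * entropy_density f c z))"
proof (intro conjI allI impI)
  fix T assume "casimir_density A g P T"
  then obtain f where f: "smooth_real f" and dep: "\<And>c. c \<in> A \<Longrightarrow>
      depends_only_on (jet_dom c) (insert Time (range Space)) (\<lambda>z. T c z - dens z * f (entr z))"
    using casimir_structure[OF assms(1,2,3)] by metis
  \<comment> \<open>A constant slope means pure mass; the identity then stands in for the
    nonconstant function, with coefficient 0.\<close>
  obtain c1 c2 f' where f': "smooth_nonconstant f'" and eq: "\<And>s. f s = c1 + c2 * f' s"
  proof (cases "f constant_on UNIV")
    case True
    then obtain k where "\<And>s. f s = k"
      unfolding constant_on_def by blast
    moreover have "\<not> (\<lambda>x :: real. x) constant_on UNIV"
      unfolding constant_on_def by (metis UNIV_I zero_neq_one)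
    ultimately show thesis
      by (intro that[of "\<lambda>x. x" k 0]) (simp_all add: smooth_nonconstant_iff smooth_real_id)
  next
    case False
    then show thesis
      using f by (intro that[of f 0 1]) (simp_all add: smooth_nonconstant_iff)
  qed
  \<comment> \<open>The difference is a function of time and position only, hence trivial by the
    first alternative.\<close>
  have "trivial_density A g (\<lambda>c z. T c z - (c1 * mass_density c z + c2 * entropy_density f' c z))"
    unfolding trivial_density_def
  proof (intro disjI1 ballI)
    fix c assume "c \<in> A"
    moreover have "c1 * mass_density c z + c2 * entropy_density f' c z = dens z * f (entr z)" for z
      by (simp add: mass_density_def entropy_density_def eq algebra_simps)
    ultimately show "depends_only_on (jet_dom c) (insert Time (range Space))
        (\<lambda>z. T c z - (c1 * mass_density c z + c2 * entropy_density f' c z))"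
      using dep by simp
  qed
  then show "\<exists>c1 c2 f. smooth_nonconstant f \<and>
      same_integral A g T (\<lambda>c z. c1 * mass_density c z + c2 * entropy_density f c z)"
    unfolding same_integral_def using f' by blast
next
  fix c1 c2 :: real and f
  assume asm: "smooth_nonconstant f \<and> (c1 \<noteq> 0 \<or> c2 \<noteq> 0)"
  define F where "F x = c1 + c2 * f x" for x
  have "smooth_real F"
    unfolding F_def[abs_def] using asm by (intro smooth_real_affine) (simp add: smooth_nonconstant_iff)
  \<comment> \<open>Nonconstancy of \<open>f\<close> enters here: it makes the constant function 1
    and \<open>f\<close> linearly independent.\<close>
  moreover have "\<exists>s. F s \<noteq> 0"
  proof (rule ccontr)
    assume "\<nexists>s. F s \<noteq> 0"
    then have zero: "c1 + c2 * f s = 0" for s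
      by (simp add: F_def)
    then have "c2 \<noteq> 0"
      using asm by auto
    then have "f s = - c1 / c2" for s
      using zero[of s] by (simp add: field_simps)
    then have "f constant_on UNIV"
      unfolding constant_on_def by blast
    then show False
      using asm by (simp add: smooth_nonconstant_iff)
  qed
  ultimately have "casimir_density A g P (\<lambda>c z. dens z * F (entr z))"
    using density_casimir[OF assms(1,3)] by blast
  moreover have "c1 * mass_density c z + c2 * entropy_density f c z = dens z * F (entr z)"
    for c :: "('m, 'n) chart" and z
    by (simp add: mass_density_def entropy_density_def F_def algebra_simps)
  ultimately show "casimir_density A g P (\<lambda>c z. c1 * mass_density c z + c2 * entropy_density f c z)"
    by presburger
qed


end
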